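(* Let $\Gamma$ be a graph with $k$ vertices (loops and multiple edges allowed), with vertex set $V$ and arc set $X$, let $G$ be a finite group, $H$ a subgroup of $G$ of index $n$, and $\alpha:X\to G$ a voltage assignment relative to $H$ (i.e. $\alpha(a^-)=\alpha(a)^{-1}$ for every arc $a$). Let $A^{\alpha}$ be the adjacency matrix of the relative lift $\Gamma^{\alpha}$ and $B$ the base matrix of $(\Gamma,\alpha)$. Then the multiset of the $kn$ eigenvalues of $A^{\alpha}$ equals the multiset union, over all $\rho\in\mathrm{Irep}(G)$, of the multisets $\mathrm{rank}(\rho(H))\cdot \mathrm{Sp}(\rho(B))$.
   Context: Every undirected edge of $\Gamma$ (including a loop) is regarded as a pair of mutually reverse arcs $a,a^-$. $G/H$ denotes the set of right cosets $Hg$. The relative lift $\Gamma^{\alpha}$ has vertex set $V\times G/H$ and arc set $X\times G/H$; for an arc $a$ from $u$ to $v$ in $\Gamma$ and $J\in G/H$, the arc $(a,J)$ goes from $(u,J)$ to $(v,J\alpha(a))$. Its adjacency matrix $A^{\alpha}$ is the $kn\times kn$ matrix indexed by $V\times G/H$ whose $((u,J),(v,J'))$ entry is the number of arcs $a$ of $\Gamma$ from $u$ to $v$ with $J\alpha(a)=J'$. The base matrix $B$ is the $k\times k$ matrix indexed by $V$ with entries in the group algebra $\mathbb{C}(G)$ given by $B_{u,v}=\alpha(a_1)+\cdots+\alpha(a_j)$, where $a_1,\dots,a_j$ are all arcs from $u$ to $v$ ($B_{u,v}=0$ if there are none). $\mathrm{Irep}(G)$ is a complete set of pairwise inequivalent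 unitary irreducible complex representations of $G$; for $\rho\in\mathrm{Irep}(G)$ of dimension $d_\rho$, $\rho(B)$ is the $d_\rho k\times d_\rho k$ block matrix obtained from $B$ by replacing each entry $B_{u,v}=\sum_t\alpha(a_t)$ by the $d_\rho\times d_\rho$ matrix $\sum_t\rho(\alpha(a_t))$ (and zero entries by zero blocks); $\mathrm{Sp}(\rho(B))$ is the multiset of its $d_\rho k$ eigenvalues. $\rho(H)=\sum_{h\in H}\rho(h)$, and for a nonnegative integer $r$, $r\cdot\mathrm{Sp}(\rho(B))$ is the multiset in which each element of $\mathrm{Sp}(\rho(B))$ is taken $r$ times (empty if $r=0$). *)

theory Defs
  imports
    Graph_Theory.Bidirected_Digraph
    Jordan_Normal_Form.Schur_Decomposition
    Jordan_Normal_Form.DL_Rank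
    "HOL-Algebra.Coset"
    "HOL-Library.Countable_Set"
    "HOL-Library.Poly_Mapping"
begin

text \<open>
  Undirected graphs with loops and multiple edges are the bidirected digraphs of the AFP: the arcs
  are paired by the fixed-point-free involution \<open>arev\<close>, so a loop consists of two mutually
  reverse arcs. The library normalises \<open>arev\<close> to be the identity on non-arcs.
\<close>

section \<open>Matrices over finite index sets and their spectra\<close>

text \<open>
  The entries are listed along the enumeration \<open>from_nat_into I\<close>; another enumeration
  gives a similar matrix, hence the same spectrum (lemma \<open>eigenvalue_mset_reindex\<close>).
\<close>

definition mat_on :: "'i set \<Rightarrow> ('i \<Rightarrow> 'i \<Rightarrow> complex) \<Rightarrow> complex mat" where
  "mat_on I M = mat (card I) (card I) (\<lambda>(i, j). M (from_nat_into I i) (from_nat_into I j))"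

text \<open>Eigenvalues counted with algebraic multiplicity.\<close>

definition eigenvalue_mset :: "complex mat \<Rightarrow> complex multiset" where
  "eigenvalue_mset A = proots (char_poly A)"

lemma mat_on_carrier: "mat_on I M \<in> carrier_mat (card I) (card I)"
  by (simp add: mat_on_def)

lemma size_eigenvalue_mset:
  assumes "A \<in> carrier_mat n n"
  shows "size (eigenvalue_mset A) = n"
  using degree_monic_char_poly[OF assms] by (simp add: eigenvalue_mset_def size_proots_complex)

lemma eigenvalue_mset_reindex:
  fixes M :: "'i \<Rightarrow> 'i \<Rightarrow> complex"
  assumes I: "finite I" and e: "bij_betw e {..<card I} I"
  shows "eigenvalue_mset (mat (card I) (card I) (\<lambda>(i, j). M (e i) (e j))) = eigenvalue_mset (mat_on I M)"
proof -
  let ?n = "card I" and ?f = "from_nat_into I"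
  let ?E = "mat ?n ?n (\<lambda>(i, j). M (e i) (e j))"
  let ?P = "mat ?n ?n (\<lambda>(i, j). if e i = ?f j then 1 else 0 :: complex)"
  let ?Q = "mat ?n ?n (\<lambda>(i, j). if ?f i = e j then 1 else 0 :: complex)"
  have f: "bij_betw ?f {..<?n} I" by (rule bij_betw_from_nat_into_finite[OF I])
  have sum_e: "(\<Sum>l = 0..<?n. g (e l)) = sum g I" for g :: "'i \<Rightarrow> complex"
    using sum.reindex_bij_betw[OF e, of g] by (simp add: lessThan_atLeast0)
  have sum_f: "(\<Sum>l = 0..<?n. g (?f l)) = sum g I" for g :: "'i \<Rightarrow> complex"
    using sum.reindex_bij_betw[OF f, of g] by (simp add: lessThan_atLeast0)
  have eI: "e i \<in> I" if "i < ?n" for i using e that by (auto simp: bij_betw_def)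
  have fI: "?f i \<in> I" if "i < ?n" for i using f that by (auto simp: bij_betw_def)
  have ee: "e i = e j \<longleftrightarrow> i = j" if "i < ?n" "j < ?n" for i j
    using e that by (auto simp: bij_betw_def inj_on_def)
  have ff: "?f i = ?f j \<longleftrightarrow> i = j" if "i < ?n" "j < ?n" for i j
    using f that by (auto simp: bij_betw_def inj_on_def)
  have "?P * ?Q = 1\<^sub>m ?n"
  proof (rule eq_matI)
    fix i j assume ij: "i < dim_row (1\<^sub>m ?n :: complex mat)" "j < dim_col (1\<^sub>m ?n :: complex mat)"
    then have "(?P * ?Q) $$ (i, j)
        = (\<Sum>l = 0..<?n. (\<lambda>x. (if e i = x then 1 else 0) * (if x = e j then 1 else 0)) (?f l))"
      by (simp add: scalar_prod_def)
    also have "\<dots> = (\<Sum>x\<in>I. if e i = x then (if e i = e j then 1 else 0) else 0)"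
      unfolding sum_f[of "\<lambda>x. (if e i = x then 1 else 0) * (if x = e j then 1 else 0)"]
      by (intro sum.cong) auto
    also have "\<dots> = 1\<^sub>m ?n $$ (i, j)" using ij I eI ee by simp
    finally show "(?P * ?Q) $$ (i, j) = 1\<^sub>m ?n $$ (i, j)" .
  qed auto
  moreover have "?Q * ?P = 1\<^sub>m ?n"
  proof (rule eq_matI)
    fix i j assume ij: "i < dim_row (1\<^sub>m ?n :: complex mat)" "j < dim_col (1\<^sub>m ?n :: complex mat)"
    then have "(?Q * ?P) $$ (i, j)
        = (\<Sum>l = 0..<?n. (\<lambda>x. (if ?f i = x then 1 else 0) * (if x = ?f j then 1 else 0)) (e l))"
      by (simp add: scalar_prod_def)
    also have "\<dots> = (\<Sum>x\<in>I. if ?f i = x then (if ?f i = ?f j then 1 else 0) else 0)"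
      unfolding sum_e[of "\<lambda>x. (if ?f i = x then 1 else 0) * (if x = ?f j then 1 else 0)"]
      by (intro sum.cong) auto
    also have "\<dots> = 1\<^sub>m ?n $$ (i, j)" using ij I fI ff by simp
    finally show "(?Q * ?P) $$ (i, j) = 1\<^sub>m ?n $$ (i, j)" .
  qed auto
  moreover have "?E = ?P * mat_on I M * ?Q"
  proof (rule eq_matI)
    fix i j assume ij: "i < dim_row (?P * mat_on I M * ?Q)" "j < dim_col (?P * mat_on I M * ?Q)"
    then have i: "i < ?n" and j: "j < ?n" by auto
    have PM: "(?P * mat_on I M) $$ (i, l) = M (e i) (?f l)" if l: "l < ?n" for l
    proof -
      have "(?P * mat_on I M) $$ (i, l)
          = (\<Sum>m = 0..<?n. (\<lambda>x. (if e i = x then 1 else 0) * M x (?f l)) (?f m))"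
        using i l by (simp add: scalar_prod_def mat_on_def)
      also have "\<dots> = (\<Sum>x\<in>I. if e i = x then M (e i) (?f l) else 0)"
        unfolding sum_f[of "\<lambda>x. (if e i = x then 1 else 0) * M x (?f l)"]
        by (intro sum.cong) auto
      finally show ?thesis using I eI i by simp
    qed
    have "(?P * mat_on I M * ?Q) $$ (i, j) = (\<Sum>l = 0..<?n. (?P * mat_on I M) $$ (i, l) * ?Q $$ (l, j))"
      using i j by (simp add: scalar_prod_def mat_on_def)
    also have "\<dots> = (\<Sum>l = 0..<?n. (\<lambda>x. M (e i) x * (if x = e j then 1 else 0)) (?f l))"
      using PM j by (intro sum.cong) auto
    also have "\<dots> = (\<Sum>x\<in>I. if x = e j then M (e i) (e j) else 0)"
      unfolding sum_f[of "\<lambda>x. M (e i) x * (if x = e j then 1 else 0)"]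
      by (intro sum.cong) auto
    also have "\<dots> = ?E $$ (i, j)" using I eI i j by simp
    finally show "?E $$ (i, j) = (?P * mat_on I M * ?Q) $$ (i, j)" by simp
  qed (auto simp: mat_on_def)
  ultimately have "similar_mat_wit ?E (mat_on I M) ?P ?Q"
    by (intro similar_mat_witI[of _ _ ?n]) (auto simp: mat_on_def)
  then have "similar_mat ?E (mat_on I M)" unfolding similar_mat_def by blast
  then show ?thesis unfolding eigenvalue_mset_def by (simp add: char_poly_similar)
qed


section \<open>Voltage assignments, relative lifts and base matrices\<close>

definition voltage_assignment ::
    "('v, 'e) pre_digraph \<Rightarrow> ('e \<Rightarrow> 'e) \<Rightarrow> ('g, 'm) monoid_scheme \<Rightarrow> ('e \<Rightarrow> 'g) \<Rightarrow> bool" where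
  "voltage_assignment \<Gamma> arev G \<alpha> \<longleftrightarrow>
     (\<forall>a\<in>arcs \<Gamma>. \<alpha> a \<in> carrier G \<and> \<alpha> (arev a) = inv\<^bsub>G\<^esub> (\<alpha> a))"

definition relative_lift ::
    "('v, 'e) pre_digraph \<Rightarrow> ('g, 'm) monoid_scheme \<Rightarrow> 'g set \<Rightarrow> ('e \<Rightarrow> 'g)
      \<Rightarrow> ('v \<times> 'g set, 'e \<times> 'g set) pre_digraph" where
  "relative_lift \<Gamma> G H \<alpha> =
     \<lparr> verts = verts \<Gamma> \<times> rcosets\<^bsub>G\<^esub> H,
       arcs = arcs \<Gamma> \<times> rcosets\<^bsub>G\<^esub> H,
       tail = (\<lambda>(a, J). (tail \<Gamma> a, J)),
       head = (\<lambda>(a, J). (head \<Gamma> a, J #>\<^bsub>G\<^esub> \<alpha> a)) \<rparr>"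

definition adjacency_mat :: "('v, 'e) pre_digraph \<Rightarrow> complex mat" where
  "adjacency_mat D =
     mat_on (verts D) (\<lambda>x y. of_nat (card {e \<in> arcs D. tail D e = x \<and> head D e = y}))"

text \<open>
  Elements of the group algebra are finitely supported functions; only its vector space
  structure is used, and the group element \<open>g\<close> is \<open>Poly_Mapping.single g 1\<close>.
\<close>

definition base_matrix ::
    "('v, 'e) pre_digraph \<Rightarrow> ('e \<Rightarrow> 'g) \<Rightarrow> 'v \<Rightarrow> 'v \<Rightarrow> ('g \<Rightarrow>\<^sub>0 complex)" where
  "base_matrix \<Gamma> \<alpha> u v =
     (\<Sum>a\<in>{a \<in> arcs \<Gamma>. tail \<Gamma> a = u \<and> head \<Gamma> a = v}. Poly_Mapping.single (\<alpha> a) 1)"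


section \<open>Unitary representations\<close>

text \<open>
  A matrix representation is a function on the type of group elements of which only the values on
  \<open>carrier G\<close> matter; its dimension is read off from the matrix of the identity.
\<close>

definition rep_dim :: "('g, 'm) monoid_scheme \<Rightarrow> ('g \<Rightarrow> complex mat) \<Rightarrow> nat" where
  "rep_dim G \<rho> = dim_row (\<rho> \<one>\<^bsub>G\<^esub>)"

definition unitary_rep :: "('g, 'm) monoid_scheme \<Rightarrow> ('g \<Rightarrow> complex mat) \<Rightarrow> bool" where
  "unitary_rep G \<rho> \<longleftrightarrow>
     (\<forall>g\<in>carrier G. \<rho> g \<in> carrier_mat (rep_dim G \<rho>) (rep_dim G \<rho>) \<and>
        mat_adjoint (\<rho> g) * \<rho> g = 1\<^sub>m (rep_dim G \<rho>)) \<and>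
     (\<forall>g\<in>carrier G. \<forall>h\<in>carrier G. \<rho> (g \<otimes>\<^bsub>G\<^esub> h) = \<rho> g * \<rho> h)"

definition irreducible_rep :: "('g, 'm) monoid_scheme \<Rightarrow> ('g \<Rightarrow> complex mat) \<Rightarrow> bool" where
  "irreducible_rep G \<rho> \<longleftrightarrow>
     0 < rep_dim G \<rho> \<and>
     (\<forall>W. VectorSpace.subspace class_ring W (module_vec TYPE(complex) (rep_dim G \<rho>)) \<and>
          (\<forall>g\<in>carrier G. \<forall>w\<in>W. \<rho> g *\<^sub>v w \<in> W) \<longrightarrow>
          W = {0\<^sub>v (rep_dim G \<rho>)} \<or> W = carrier_vec (rep_dim G \<rho>))"

definition equivalent_reps ::
    "('g, 'm) monoid_scheme \<Rightarrow> ('g \<Rightarrow> complex mat) \<Rightarrow> ('g \<Rightarrow> complex mat) \<Rightarrow> bool" where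
  "equivalent_reps G \<rho> \<sigma> \<longleftrightarrow>
     (\<exists>T. T \<in> carrier_mat (rep_dim G \<sigma>) (rep_dim G \<rho>) \<and> invertible_mat T \<and>
        (\<forall>g\<in>carrier G. T * \<rho> g = \<sigma> g * T))"

text \<open>
  Equivalent members must be equal as functions, so \<open>Irep\<close> contains exactly one member of each
  equivalence class. Finiteness of \<open>Irep\<close> is a consequence when \<open>G\<close> is finite and is not assumed.
\<close>

definition complete_unitary_irreps ::
    "('g, 'm) monoid_scheme \<Rightarrow> ('g \<Rightarrow> complex mat) set \<Rightarrow> bool" where
  "complete_unitary_irreps G Irep \<longleftrightarrow>
     (\<forall>\<rho>\<in>Irep. unitary_rep G \<rho> \<and> irreducible_rep G \<rho>) \<and>
     (\<forall>\<rho>\<in>Irep. \<forall>\<sigma>\<in>Irep. equivalent_reps G \<rho> \<sigma> \<longrightarrow> \<rho> = \<sigma>) \<and>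
     (\<forall>\<sigma>. unitary_rep G \<sigma> \<and> irreducible_rep G \<sigma> \<longrightarrow> (\<exists>\<rho>\<in>Irep. equivalent_reps G \<rho> \<sigma>))"

text \<open>Linear extension of a representation to the group algebra.\<close>

definition rep_alg ::
    "('g, 'm) monoid_scheme \<Rightarrow> ('g \<Rightarrow> complex mat) \<Rightarrow> ('g \<Rightarrow>\<^sub>0 complex) \<Rightarrow> complex mat" where
  "rep_alg G \<rho> x = mat (rep_dim G \<rho>) (rep_dim G \<rho>)
     (\<lambda>(i, j). \<Sum>g\<in>Poly_Mapping.keys x. Poly_Mapping.lookup x g * \<rho> g $$ (i, j))"

definition rep_subset_sum ::
    "('g, 'm) monoid_scheme \<Rightarrow> ('g \<Rightarrow> complex mat) \<Rightarrow> 'g set \<Rightarrow> complex mat" where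
  "rep_subset_sum G \<rho> S = rep_alg G \<rho> (\<Sum>h\<in>S. Poly_Mapping.single h 1)"

definition rep_base_matrix ::
    "('v, 'e) pre_digraph \<Rightarrow> ('g, 'm) monoid_scheme \<Rightarrow> ('e \<Rightarrow> 'g) \<Rightarrow> ('g \<Rightarrow> complex mat)
      \<Rightarrow> complex mat" where
  "rep_base_matrix \<Gamma> G \<alpha> \<rho> =
     mat_on (verts \<Gamma> \<times> {..<rep_dim G \<rho>})
       (\<lambda>(u, i) (v, j). rep_alg G \<rho> (base_matrix \<Gamma> \<alpha> u v) $$ (i, j))"


section \<open>Explicit forms of the entries\<close>

lemma adjacency_relative_lift_entry:
  assumes "J \<in> rcosets\<^bsub>G\<^esub> H"
  shows "card {e \<in> arcs (relative_lift \<Gamma> G H \<alpha>).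
           tail (relative_lift \<Gamma> G H \<alpha>) e = (u, J) \<and> head (relative_lift \<Gamma> G H \<alpha>) e = (v, J')}
       = card {a \<in> arcs \<Gamma>. tail \<Gamma> a = u \<and> head \<Gamma> a = v \<and> J #>\<^bsub>G\<^esub> \<alpha> a = J'}"
    (is "card ?L = card ?R")
proof -
  have "?L = (\<lambda>a. (a, J)) ` ?R" using assms by (auto simp: relative_lift_def)
  then show ?thesis by (simp add: card_image inj_on_def)
qed

lemma rep_alg_sum_single:
  assumes "finite S" "i < rep_dim G \<rho>" "j < rep_dim G \<rho>"
  shows "rep_alg G \<rho> (\<Sum>s\<in>S. Poly_Mapping.single (f s) 1) $$ (i, j) = (\<Sum>s\<in>S. \<rho> (f s) $$ (i, j))"
proof -
  let ?x = "\<Sum>s\<in>S. Poly_Mapping.single (f s) (1 :: complex)"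
  have lk: "Poly_Mapping.lookup ?x g = (\<Sum>s\<in>S. if f s = g then 1 else 0)" for g
    by (simp add: lookup_sum lookup_single when_def)
  have sub: "Poly_Mapping.keys ?x \<subseteq> f ` S"
  proof
    fix g assume "g \<in> Poly_Mapping.keys ?x"
    then have "Poly_Mapping.lookup ?x g \<noteq> 0" by (simp add: in_keys_iff)
    then show "g \<in> f ` S" unfolding lk
      by (elim sum.not_neutral_contains_not_neutral) (auto split: if_splits)
  qed
  have "rep_alg G \<rho> ?x $$ (i, j) = (\<Sum>g\<in>Poly_Mapping.keys ?x. Poly_Mapping.lookup ?x g * \<rho> g $$ (i, j))"
    using assms by (simp add: rep_alg_def)
  also have "\<dots> = (\<Sum>g\<in>f ` S. Poly_Mapping.lookup ?x g * \<rho> g $$ (i, j))"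
    using assms sub by (intro sum.mono_neutral_left) (auto simp: in_keys_iff)
  also have "\<dots> = (\<Sum>g\<in>f ` S. \<Sum>s\<in>S. if f s = g then \<rho> (f s) $$ (i, j) else 0)"
    unfolding lk sum_distrib_right by (intro sum.cong) auto
  also have "\<dots> = (\<Sum>s\<in>S. \<Sum>g\<in>f ` S. if f s = g then \<rho> (f s) $$ (i, j) else 0)"
    by (rule sum.swap)
  also have "\<dots> = (\<Sum>s\<in>S. \<rho> (f s) $$ (i, j))" using assms by (intro sum.cong) auto
  finally show ?thesis .
qed

end

(*
  The lift decomposes along the permutation representation R of G on the right cosets of H:
  A = sum over arcs a of E_(u,v) (x) R(alpha(a)). The multiplicity of rho in R is the dimension of
  the H-fixed vectors of rho, which is the rank of the projection P = rho(H)/|H|. Factoring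
  P = U W with W U = 1 makes the intertwiner explicit: the matrix with entries (W rho(g))_(j,i) in row
  Hg and column (rho,j,i) has the left inverse (d_rho/n) (rho(g^-1) U)_(i,j) by Schur orthogonality.
  The left inverse has trivial kernel, because a minimal nonzero invariant subspace of the kernel
  would carry some rho in Irep, whose row at the coset H is both fixed by H and annihilated by U and
  therefore zero. So both matrices are invertible, and A is similar
  to the block diagonal matrix with rank(rho(H)) copies of rho(B) for each rho.
*)

theory Submission
  imports
    Defs
    "Jordan_Normal_Form.Spectral_Radius"
begin

section \<open>Spectra of matrices over finite index sets\<close>

text \<open>Orthogonality yields only one of the two inverse relations, because the number of
  columns of the intertwiner is not known beforehand. The usual remedy is the count that the sum of
  d_\<rho> rank(\<rho>(H)) over all \<rho> equals n, from complete reducibility and Frobenius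
  reciprocity. The kernel argument replaces that count: it needs a single irreducible
  subrepresentation rather than a full decomposition, and the equality of sizes then follows from
  having both relations. That subrepresentation must be a unitary matrix representation, since
  completeness of \<open>Irep\<close> speaks of nothing else. Hence invariant subspaces are
  described by isometries: if the orthonormal columns of E span an invariant subspace of R, then the
  adjoint of E times R(g) E is again unitary. The orthogonality relation is proved with an arbitrary
  row w in front of \<rho>(g), because it is used twice: a row of W gives the left inverse, and a
  row of the hypothetical copy of \<rho> in the kernel gives w U = 0.\<close>

lemma right_inverse_dim_le:
  fixes A :: "'a :: field mat"
  assumes A: "A \<in> carrier_mat n m" and B: "B \<in> carrier_mat m n" and AB: "A * B = 1\<^sub>m n"
  shows "n \<le> m"
proof (rule ccontr)
  assume "\<not> n \<le> m"
  then have m: "m < n" by simp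
  \<comment> \<open>Padding with zeros to square size keeps the product equal to 1, so the padded
    factors commute; but row \<open>m\<close> of \<open>?B\<close> is zero.\<close>
  let ?A = "mat n n (\<lambda>(i, j). if j < m then A $$ (i, j) else 0)"
  let ?B = "mat n n (\<lambda>(i, j). if i < m then B $$ (i, j) else 0)"
  have "?A * ?B = A * B"
  proof (rule eq_matI)
    fix i j assume "i < dim_row (A * B)" "j < dim_col (A * B)"
    then have ij: "i < n" "j < n" using A B by auto
    have "(?A * ?B) $$ (i, j) = (\<Sum>l = 0..<n. if l < m then A $$ (i, l) * B $$ (l, j) else 0)"
      using ij by (simp add: scalar_prod_def if_distrib cong: if_cong)
    also have "\<dots> = (\<Sum>l = 0..<m. A $$ (i, l) * B $$ (l, j))"
      using m by (intro sum.mono_neutral_cong_right) auto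
    also have "\<dots> = (A * B) $$ (i, j)" using ij A B by (simp add: scalar_prod_def)
    finally show "(?A * ?B) $$ (i, j) = (A * B) $$ (i, j)" .
  qed (use A B in auto)
  then have "?A * ?B = 1\<^sub>m n" unfolding AB .
  then have "?B * ?A = 1\<^sub>m n" by (rule mat_mult_left_right_inverse[OF mat_carrier mat_carrier])
  then have "(?B * ?A) $$ (m, m) = 1" using m by (simp only: index_one_mat refl if_True)
  moreover have "(?B * ?A) $$ (m, m) = 0" using m by (simp add: scalar_prod_def)
  ultimately show False by simp
qed

text \<open>Rectangular companion of \<open>mat_on\<close>: the change of basis has rows and columns
  indexed by sets of different types.\<close>

definition indexed_mat :: "'i set \<Rightarrow> 'j set \<Rightarrow> ('i \<Rightarrow> 'j \<Rightarrow> complex) \<Rightarrow> complex mat" where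
  "indexed_mat I J M =
     mat (card I) (card J) (\<lambda>(i, j). M (from_nat_into I i) (from_nat_into J j))"

lemma indexed_mat_carrier [simp]: "indexed_mat I J M \<in> carrier_mat (card I) (card J)"
  by (simp add: indexed_mat_def)

lemma mat_on_eq_indexed_mat: "mat_on I M = indexed_mat I I M"
  by (simp add: mat_on_def indexed_mat_def)

lemma from_nat_into_card_mem: "i < card I \<Longrightarrow> from_nat_into I i \<in> I"
  by (metis card.empty from_nat_into not_less_zero)

lemma indexed_mat_cong:
  assumes "\<And>x y. x \<in> I \<Longrightarrow> y \<in> J \<Longrightarrow> M x y = N x y"
  shows "indexed_mat I J M = indexed_mat I J N"
  using assms by (auto simp: indexed_mat_def from_nat_into_card_mem intro!: cong_mat)

lemma indexed_mat_mult:
  assumes "finite J"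
  shows "indexed_mat I J M * indexed_mat J K N = indexed_mat I K (\<lambda>x z. \<Sum>y\<in>J. M x y * N y z)"
proof (rule eq_matI)
  fix i j assume ij: "i < dim_row (indexed_mat I K (\<lambda>x z. \<Sum>y\<in>J. M x y * N y z))"
    "j < dim_col (indexed_mat I K (\<lambda>x z. \<Sum>y\<in>J. M x y * N y z))"
  have "(\<Sum>l<card J. g (from_nat_into J l)) = sum g J" for g :: "_ \<Rightarrow> complex"
    using sum.reindex_bij_betw[OF bij_betw_from_nat_into_finite[OF assms], of g] .
  then show "(indexed_mat I J M * indexed_mat J K N) $$ (i, j) =
      indexed_mat I K (\<lambda>x z. \<Sum>y\<in>J. M x y * N y z) $$ (i, j)"
    using ij by (simp add: indexed_mat_def scalar_prod_def atLeast0LessThan)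
qed (auto simp: indexed_mat_def)

lemma indexed_mat_one:
  assumes "finite I"
  shows "indexed_mat I I (\<lambda>x y. of_bool (x = y)) = 1\<^sub>m (card I)"
proof -
  have "from_nat_into I i = from_nat_into I j \<longleftrightarrow> i = j" if "i < card I" "j < card I" for i j
    using bij_betw_from_nat_into_finite[OF assms] that by (auto simp: bij_betw_def inj_on_def)
  then show ?thesis by (intro eq_matI) (auto simp: indexed_mat_def)
qed

text \<open>Serves twice: it forces equal sizes of the two index sets in a change of basis, and it
  bounds the size of an orthogonal family of functions on a finite set.\<close>

lemma right_inverse_card_le:
  fixes p :: "'i \<Rightarrow> 'j \<Rightarrow> complex"
  assumes "finite I" "finite J"
    and pq: "\<And>x y. x \<in> I \<Longrightarrow> y \<in> I \<Longrightarrow> (\<Sum>z\<in>J. p x z * q z y) = of_bool (x = y)"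
  shows "card I \<le> card J"
proof (rule right_inverse_dim_le)
  show "indexed_mat I J p * indexed_mat J I q = 1\<^sub>m (card I)"
    unfolding indexed_mat_mult[OF \<open>finite J\<close>] indexed_mat_one[OF \<open>finite I\<close>, symmetric]
    by (rule indexed_mat_cong[OF pq])
qed auto

text \<open>Similarity across two index types. Having both \<open>pq\<close> and \<open>qp\<close>
  forces equal cardinalities, so the rectangular matrices are square after enumeration, and
  \<open>AD\<close> reads A P = P D.\<close>

lemma eigenvalue_mset_similar:
  fixes p :: "'i \<Rightarrow> 'j \<Rightarrow> complex"
  assumes I: "finite I" and J: "finite J"
    and pq: "\<And>x y. x \<in> I \<Longrightarrow> y \<in> I \<Longrightarrow> (\<Sum>z\<in>J. p x z * q z y) = of_bool (x = y)"
    and qp: "\<And>x y. x \<in> J \<Longrightarrow> y \<in> J \<Longrightarrow> (\<Sum>z\<in>I. q x z * p z y) = of_bool (x = y)"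
    and AD: "\<And>x y. x \<in> I \<Longrightarrow> y \<in> J \<Longrightarrow> (\<Sum>z\<in>I. A x z * p z y) = (\<Sum>z\<in>J. p x z * D z y)"
  shows "eigenvalue_mset (mat_on I A) = eigenvalue_mset (mat_on J D)"
proof -
  let ?P = "indexed_mat I J p" and ?Q = "indexed_mat J I q"
  have card: "card I = card J"
    using right_inverse_card_le[OF I J pq] right_inverse_card_le[OF J I qp] by simp
  have PQ: "?P * ?Q = 1\<^sub>m (card J)"
    unfolding card[symmetric] indexed_mat_mult[OF J] indexed_mat_one[OF I, symmetric]
    by (rule indexed_mat_cong[OF pq])
  have QP: "?Q * ?P = 1\<^sub>m (card J)"
    unfolding indexed_mat_mult[OF I] indexed_mat_one[OF J, symmetric]
    by (rule indexed_mat_cong[OF qp])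
  have AP: "mat_on I A * ?P = ?P * mat_on J D"
    unfolding mat_on_eq_indexed_mat indexed_mat_mult[OF I] indexed_mat_mult[OF J] by (rule indexed_mat_cong[OF AD])
  have carr: "?P \<in> carrier_mat (card J) (card J)" "?Q \<in> carrier_mat (card J) (card J)"
    "mat_on I A \<in> carrier_mat (card J) (card J)" "mat_on J D \<in> carrier_mat (card J) (card J)"
    using card mat_on_carrier[of I A] mat_on_carrier[of J D]
      indexed_mat_carrier[of I J p] indexed_mat_carrier[of J I q] by auto
  have "?P * mat_on J D * ?Q = mat_on I A * (?P * ?Q)"
    unfolding AP[symmetric] using carr by (intro assoc_mult_mat) auto
  then have "mat_on I A = ?P * mat_on J D * ?Q" using carr by (simp add: PQ)
  then have "similar_mat_wit (mat_on I A) (mat_on J D) ?P ?Q"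
    using carr PQ QP by (intro similar_mat_witI[of _ _ "card J"]) auto
  then show ?thesis unfolding eigenvalue_mset_def
    by (metis char_poly_similar similar_mat_def)
qed

lemma eigenvalue_mset_image:
  assumes "finite I" "inj_on f I"
  shows "eigenvalue_mset (mat_on (f ` I) M) = eigenvalue_mset (mat_on I (\<lambda>x y. M (f x) (f y)))"
proof -
  have "bij_betw (f \<circ> from_nat_into I) {..<card (f ` I)} (f ` I)"
    using assms by (auto simp: card_image intro!: bij_betw_trans bij_betw_from_nat_into_finite
        inj_on_imp_bij_betw)
  from eigenvalue_mset_reindex[OF _ this, of M] assms show ?thesis
    by (simp add: mat_on_def card_image)
qed

lemma eigenvalue_mset_Un:
  assumes I: "finite I" and J: "finite J" and IJ: "I \<inter> J = {}"
    and M: "\<And>x y. x \<in> I \<Longrightarrow> y \<in> J \<Longrightarrow> M x y = 0 \<and> M y x = 0"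
  shows "eigenvalue_mset (mat_on (I \<union> J) M) = eigenvalue_mset (mat_on I M) + eigenvalue_mset (mat_on J M)"
proof -
  let ?a = "card I" and ?b = "card J"
  \<comment> \<open>This enumeration lists \<open>I\<close> before \<open>J\<close>, which makes the
    matrix a literal block matrix; \<open>eigenvalue_mset_reindex\<close> permits any
    enumeration.\<close>
  let ?e = "\<lambda>i. if i < ?a then from_nat_into I i else from_nat_into J (i - ?a)"
  have card: "card (I \<union> J) = ?a + ?b" using I J IJ by (rule card_Un_disjoint)
  have "bij_betw ?e ({..<?a} \<union> {?a..<?a + ?b}) (I \<union> J)"
  proof (rule bij_betw_combine[OF _ _ IJ])
    show "bij_betw ?e {..<?a} I"
      using bij_betw_from_nat_into_finite[OF I] by (rule bij_betw_cong[THEN iffD1, rotated]) auto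
    have "bij_betw (\<lambda>i. i - ?a) {?a..<?a + ?b} {..<?b}"
      by (rule bij_betw_byWitness[of _ "\<lambda>i. i + ?a"]) auto
    from bij_betw_trans[OF this bij_betw_from_nat_into_finite[OF J]]
    show "bij_betw ?e {?a..<?a + ?b} J"
      by (rule bij_betw_cong[THEN iffD1, rotated]) auto
  qed
  moreover have "{..<?a} \<union> {?a..<?a + ?b} = {..<card (I \<union> J)}" unfolding card by auto
  ultimately have e: "bij_betw ?e {..<card (I \<union> J)} (I \<union> J)" by simp
  have block: "mat (card (I \<union> J)) (card (I \<union> J)) (\<lambda>(i, j). M (?e i) (?e j))
      = four_block_mat (mat_on I M) (0\<^sub>m ?a ?b) (0\<^sub>m ?b ?a) (mat_on J M)"
  proof (rule eq_matI, goal_cases)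
    case (1 i j)
    then have ij: "i < ?a + ?b" "j < ?a + ?b" by (auto simp: mat_on_def)
    moreover from ij have "\<not> l < ?a \<Longrightarrow> l - ?a < ?b" if "l < ?a + ?b" for l
      using that by linarith
    ultimately show ?case
      using M by (cases "i < ?a"; cases "j < ?a") (auto simp: card mat_on_def from_nat_into_card_mem)
  qed (simp_all add: card mat_on_def)
  \<comment> \<open>Over the complex numbers both diagonal blocks have characteristic polynomials
    that split into linear factors, which feeds \<open>char_poly_0_block\<close>.\<close>
  have "char_poly (four_block_mat (mat_on I M) (0\<^sub>m ?a ?b) (0\<^sub>m ?b ?a) (mat_on J M))
      = char_poly (mat_on I M) * char_poly (mat_on J M)"
    using char_poly_factorized[OF mat_on_carrier[of I M]] char_poly_factorized[OF mat_on_carrier[of J M]]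
    by (intro char_poly_0_block[OF refl]) (auto intro: mat_on_carrier)
  moreover have "char_poly (mat_on K M) \<noteq> 0" for K
    using degree_monic_char_poly[OF mat_on_carrier[of K M]] by auto
  ultimately show ?thesis
    using eigenvalue_mset_reindex[OF _ e, of M] I J
    by (simp add: block eigenvalue_mset_def proots_mult)
qed

lemma eigenvalue_mset_block_diag:
  assumes "finite S" "\<And>s. s \<in> S \<Longrightarrow> finite (X s)"
  shows "eigenvalue_mset (mat_on (Sigma S X) (\<lambda>(s, x) (t, y). if s = t then M s x y else 0))
       = (\<Sum>s\<in>S. eigenvalue_mset (mat_on (X s) (M s)))"
  using assms
proof (induction S rule: finite_induct)
  case empty
  then show ?case using size_eigenvalue_mset[OF mat_on_carrier, of "{}"] by simp
next
  case (insert s S)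
  let ?N = "\<lambda>(s, x) (t, y). if s = t then M s x y else 0"
  have "eigenvalue_mset (mat_on (Sigma (insert s S) X) ?N)
      = eigenvalue_mset (mat_on (Pair s ` X s \<union> Sigma S X) ?N)"
    by (rule arg_cong[where f = "\<lambda>I. eigenvalue_mset (mat_on I ?N)"]) auto
  also have "\<dots> = eigenvalue_mset (mat_on (Pair s ` X s) ?N) + eigenvalue_mset (mat_on (Sigma S X) ?N)"
    using insert by (intro eigenvalue_mset_Un) auto
  also have "eigenvalue_mset (mat_on (Pair s ` X s) ?N) = eigenvalue_mset (mat_on (X s) (M s))"
    using insert by (subst eigenvalue_mset_image) (auto simp: inj_on_def)
  finally show ?case using insert by simp
qed

lemma sum_constant_mset: "(\<Sum>j<m. A) = repeat_mset m A" for A :: "'a multiset"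
  by (induction m) (simp_all add: add.commute)

section \<open>Isometries and rank factorizations\<close>

text \<open>Unfolds the abstract subspace predicate, over which \<open>irreducible_rep\<close>
  quantifies, into closure properties of a set of vectors.\<close>

lemma subspace_module_vecD:
  assumes "VectorSpace.subspace class_ring W (module_vec TYPE('a :: field) n)"
  shows "W \<subseteq> carrier_vec n" "0\<^sub>v n \<in> W"
    "\<And>u v. u \<in> W \<Longrightarrow> v \<in> W \<Longrightarrow> u + v \<in> W"
    "\<And>(c :: 'a) v. v \<in> W \<Longrightarrow> c \<cdot>\<^sub>v v \<in> W"
proof -
  interpret vec_space "TYPE('a)" n .
  have sub: "submodule class_ring W V" using assms by (simp add: subspace_def)
  then show "W \<subseteq> carrier_vec n" "0\<^sub>v n \<in> W"
    "\<And>u v. u \<in> W \<Longrightarrow> v \<in> W \<Longrightarrow> u + v \<in> W"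
    "\<And>(c :: 'a) v. v \<in> W \<Longrightarrow> c \<cdot>\<^sub>v v \<in> W"
    unfolding submodule_def by (auto simp: module_vec_simps class_ring_simps)
qed

lemma subspace_module_vecI:
  assumes "W \<subseteq> carrier_vec n" "0\<^sub>v n \<in> W"
    "\<And>u v. u \<in> W \<Longrightarrow> v \<in> W \<Longrightarrow> u + v \<in> W"
    "\<And>(c :: 'a :: field) v. v \<in> W \<Longrightarrow> c \<cdot>\<^sub>v v \<in> W"
  shows "VectorSpace.subspace class_ring W (module_vec TYPE('a) n)"
proof -
  interpret vec_space "TYPE('a)" n .
  have "submodule class_ring W V"
    unfolding submodule_def using assms by (simp add: vec_module module_vec_simps class_ring_simps)
  then show ?thesis unfolding subspace_def using vec_vs by blast
qed

lemma mat_mult_unit_vec: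
  fixes A :: "'a :: comm_semiring_1 mat"
  assumes "A \<in> carrier_mat n m" "i < m"
  shows "A *\<^sub>v unit_vec m i = col A i"
  using assms by (intro eq_vecI) (auto simp: scalar_prod_def if_distrib cong: if_cong)

lemma mat_eqI_mult_vec:
  fixes A B :: "'a :: comm_semiring_1 mat"
  assumes "A \<in> carrier_mat n m" "B \<in> carrier_mat n m"
    and "\<And>v. v \<in> carrier_vec m \<Longrightarrow> A *\<^sub>v v = B *\<^sub>v v"
  shows "A = B"
proof (rule mat_col_eqI)
  fix i assume "i < dim_col B"
  then show "col A i = col B i"
    using assms(1,2) assms(3)[of "unit_vec m i"] by (simp add: mat_mult_unit_vec)
qed (use assms in auto)

lemma dim_mat_adjoint [simp]:
  "dim_row (mat_adjoint A) = dim_col A" "dim_col (mat_adjoint A) = dim_row A"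
  by (auto simp: mat_adjoint_def)

lemma mat_adjoint_carrier [simp]: "A \<in> carrier_mat n m \<Longrightarrow> mat_adjoint A \<in> carrier_mat m n"
  by (auto simp: mat_adjoint_def)

lemma mat_adjoint_index:
  "i < dim_col A \<Longrightarrow> j < dim_row A \<Longrightarrow> mat_adjoint A $$ (i, j) = conjugate (A $$ (j, i))"
  by (simp add: mat_adjoint_def mat_of_rows_index)

lemma mat_adjoint_indexed_mat:
  "mat_adjoint (indexed_mat I J M) = indexed_mat J I (\<lambda>x y. cnj (M y x))"
  by (intro eq_matI) (auto simp: mat_adjoint_index indexed_mat_def)

lemma mat_adjoint_mult:
  assumes "A \<in> carrier_mat n m" "B \<in> carrier_mat m k"
  shows "mat_adjoint (A * B) = mat_adjoint B * mat_adjoint A"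
  using assms
  by (intro eq_matI) (auto simp: mat_adjoint_index scalar_prod_def sum_conjugate conjugate_dist_mul
      mult.commute intro!: sum.cong)

text \<open>The isometry \<open>F\<close> is chosen with as many columns as possible.\<close>

lemma subspace_isometry:
  fixes W :: "complex vec set"
  assumes W: "VectorSpace.subspace class_ring W (module_vec TYPE(complex) n)"
  obtains m F where "F \<in> carrier_mat n m" "mat_adjoint F * F = 1\<^sub>m m"
    "W = (*\<^sub>v) F ` carrier_vec m"
proof -
  note WD = subspace_module_vecD[OF W]
  define P where "P m \<longleftrightarrow> (\<exists>F. F \<in> carrier_mat n m \<and> mat_adjoint F * F = 1\<^sub>m m \<and>
      (*\<^sub>v) F ` carrier_vec m \<subseteq> W)" for m
  have "P 0" unfolding P_def
  proof (intro exI conjI)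
    show "0\<^sub>m n 0 \<in> carrier_mat n 0" by simp
    show "mat_adjoint (0\<^sub>m n 0 :: complex mat) * 0\<^sub>m n 0 = 1\<^sub>m 0"
      by (intro eq_matI) auto
    have "0\<^sub>m n 0 *\<^sub>v v = 0\<^sub>v n" if "v \<in> carrier_vec 0" for v :: "complex vec"
      using that by (intro eq_vecI) (auto simp: scalar_prod_def)
    then show "(*\<^sub>v) (0\<^sub>m n 0) ` carrier_vec 0 \<subseteq> W" using WD(2) by auto
  qed
  \<comment> \<open>The adjoint is a left inverse, so an isometry into dimension \<open>n\<close>
    has at most \<open>n\<close> columns and a largest \<open>m\<close> exists.\<close>
  moreover have bound: "m \<le> n" if "P m" for m
    using that right_inverse_dim_le[of _ m n] unfolding P_def by (metis mat_adjoint_carrier)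
  ultimately obtain m where m: "P m" and max: "\<And>k. P k \<Longrightarrow> k \<le> m"
    using GreatestI_nat[of P 0 n] Greatest_le_nat[of P _ n] by metis
  then obtain F where F: "F \<in> carrier_mat n m" and FF: "mat_adjoint F * F = 1\<^sub>m m"
    and FW: "(*\<^sub>v) F ` carrier_vec m \<subseteq> W" unfolding P_def by blast
  note Fa = mat_adjoint_carrier[OF F]
  have "W \<subseteq> (*\<^sub>v) F ` carrier_vec m"
  proof
    fix w assume w: "w \<in> W"
    then have wn: "w \<in> carrier_vec n" using WD by blast
    define x where "x = mat_adjoint F *\<^sub>v w"
    have x: "x \<in> carrier_vec m" using Fa wn by (simp add: x_def)
    \<comment> \<open>The component of \<open>w\<close> orthogonal to the columns of
      \<open>F\<close>; if nonzero, it would supply one more orthonormal column.\<close>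
    define u where "u = w - F *\<^sub>v x"
    have un: "u \<in> carrier_vec n" using F wn x by (simp add: u_def)
    have "u = w + (-1) \<cdot>\<^sub>v (F *\<^sub>v x)" using F wn x by (auto simp: u_def)
    then have uW: "u \<in> W" using WD w FW x by auto
    have "mat_adjoint F *\<^sub>v u = mat_adjoint F *\<^sub>v w - mat_adjoint F *\<^sub>v (F *\<^sub>v x)"
      unfolding u_def using F x by (intro mult_minus_distrib_mat_vec[OF Fa wn]) simp
    then have Fu: "mat_adjoint F *\<^sub>v u = 0\<^sub>v m"
      using x by (simp add: assoc_mult_mat_vec[OF Fa F x, symmetric] FF x_def[symmetric])
    have "u = 0\<^sub>v n"
    proof (rule ccontr)
      assume "u \<noteq> 0\<^sub>v n"
      then have "u \<bullet>c u > 0" using un by (simp add: conjugate_square_greater_0_vec)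
      then have r: "u \<bullet>c u = complex_of_real (Re (u \<bullet>c u))" "Re (u \<bullet>c u) > 0"
        by (simp_all add: complex_eq_iff less_complex_def)
      define r where "r = Re (u \<bullet>c u)"
      \<comment> \<open>\<open>c\<close> scales \<open>u\<close> to norm one, \<open>r\<close> being
        its squared norm.\<close>
      define c where "c = complex_of_real (1 / sqrt r)"
      have "cnj c * c = complex_of_real (1 / r)"
        using r(2) by (simp add: c_def r_def of_real_mult[symmetric] del: of_real_mult of_real_divide)
      then have c: "cnj c * c * (u \<bullet>c u) = 1" using r by (simp add: r_def[symmetric])
      define F' where "F' = mat n (Suc m) (\<lambda>(i, j). if j < m then F $$ (i, j) else c * u $ i)"
      have F': "F' \<in> carrier_mat n (Suc m)" by (simp add: F'_def)
      note Fa' = mat_adjoint_carrier[OF F']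
      have orth: "(\<Sum>l = 0..<n. cnj (F $$ (l, i)) * u $ l) = 0" if "i < m" for i
        using arg_cong[OF Fu, of "\<lambda>v. v $ i"] that F un Fa
        by (simp add: scalar_prod_def mat_adjoint_index)
      have orth': "(\<Sum>l = 0..<n. cnj (u $ l) * F $$ (l, i)) = 0" if "i < m" for i
        using arg_cong[OF orth[OF that], of cnj] by (simp add: mult.commute)
      have norm: "(\<Sum>l = 0..<n. cnj (F $$ (l, i)) * F $$ (l, j)) = of_bool (i = j)" if "i < m" "j < m" for i j
        using arg_cong[OF FF, of "\<lambda>M. M $$ (i, j)"] that F Fa
        by (simp add: scalar_prod_def mat_adjoint_index)
      have uu: "(\<Sum>l = 0..<n. cnj (u $ l) * u $ l) = u \<bullet>c u"
        using un by (simp add: scalar_prod_def mult.commute)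
      have "mat_adjoint F' * F' = 1\<^sub>m (Suc m)"
      proof (rule eq_matI, goal_cases)
        case (1 i j)
        then have ij: "i < Suc m" "j < Suc m" by auto
        then have "(mat_adjoint F' * F') $$ (i, j) = (\<Sum>l = 0..<n. cnj (F' $$ (l, i)) * F' $$ (l, j))"
          using F' Fa' by (simp add: scalar_prod_def mat_adjoint_index)
        also have "\<dots> = (if i < m then if j < m then \<Sum>l = 0..<n. cnj (F $$ (l, i)) * F $$ (l, j)
              else c * (\<Sum>l = 0..<n. cnj (F $$ (l, i)) * u $ l)
            else if j < m then cnj c * (\<Sum>l = 0..<n. cnj (u $ l) * F $$ (l, j))
              else cnj c * c * (\<Sum>l = 0..<n. cnj (u $ l) * u $ l))"
          using ij by (auto simp: F'_def sum_distrib_left mult_ac intro!: sum.cong)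
        also have "\<dots> = of_bool (i = j)" using ij by (auto simp: norm orth orth' uu c)
        finally show ?case using ij by simp
      qed (use F' Fa' in auto)
      moreover have "F' *\<^sub>v v \<in> W" if v: "v \<in> carrier_vec (Suc m)" for v
      proof -
        have "F' *\<^sub>v v = F *\<^sub>v vec_first v m + (v $ m * c) \<cdot>\<^sub>v u"
          using v F F' un by (intro eq_vecI) (auto simp: F'_def scalar_prod_def vec_first_def)
        moreover have "F *\<^sub>v vec_first v m \<in> W" using FW by auto
        ultimately show ?thesis using WD uW by simp
      qed
      ultimately have "P (Suc m)" unfolding P_def using F' by blast
      then show False using max by fastforce
    qed
    moreover have "w = u + F *\<^sub>v x" using F wn by (intro eq_vecI) (auto simp: u_def)
    ultimately have "w = F *\<^sub>v x" using F x by simp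
    then show "w \<in> (*\<^sub>v) F ` carrier_vec m" using x by blast
  qed
  then show thesis using that F FF FW by blast
qed

section \<open>Column spaces, rank and the splitting of idempotents\<close>

lemma mult_vec_image_subspace:
  fixes A :: "'a :: field mat"
  assumes A: "A \<in> carrier_mat n m"
  shows "VectorSpace.subspace class_ring ((*\<^sub>v) A ` carrier_vec m) (module_vec TYPE('a) n)"
proof (rule subspace_module_vecI)
  show "(*\<^sub>v) A ` carrier_vec m \<subseteq> carrier_vec n" using A by auto
  show "0\<^sub>v n \<in> (*\<^sub>v) A ` carrier_vec m"
    using A by (intro image_eqI[of _ _ "0\<^sub>v m"]) auto
next
  fix u v assume "u \<in> (*\<^sub>v) A ` carrier_vec m" "v \<in> (*\<^sub>v) A ` carrier_vec m"
  then obtain x y where "x \<in> carrier_vec m" "y \<in> carrier_vec m" "u = A *\<^sub>v x" "v = A *\<^sub>v y" by auto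
  then show "u + v \<in> (*\<^sub>v) A ` carrier_vec m"
    using A by (intro image_eqI[of _ _ "x + y"]) (auto simp: mult_add_distrib_mat_vec)
next
  fix c v assume "v \<in> (*\<^sub>v) A ` carrier_vec m"
  then obtain x where "x \<in> carrier_vec m" "v = A *\<^sub>v x" by auto
  then show "c \<cdot>\<^sub>v v \<in> (*\<^sub>v) A ` carrier_vec m"
    using A by (intro image_eqI[of _ _ "c \<cdot>\<^sub>v x"]) (auto simp: mult_mat_vec)
qed

text \<open>The rank depends only on the column space, which is the image of the matrix as a linear
  map.\<close>

lemma rank_eqI_image:
  fixes A B :: "'a :: field mat"
  assumes A: "A \<in> carrier_mat n m" and B: "B \<in> carrier_mat n k"
    and img: "(*\<^sub>v) A ` carrier_vec m = (*\<^sub>v) B ` carrier_vec k"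
  shows "vec_space.rank n A = vec_space.rank n B"
proof -
  have "vec_space.col_space n C = (*\<^sub>v) C ` carrier_vec l" if "C \<in> carrier_mat n l"
    for C :: "'a mat" and l
    using that by (auto simp: vec_space.col_space_eq[OF that])
  then have "vec_space.col_space n A = vec_space.col_space n B" using A B img by simp
  then show ?thesis unfolding vec_space.rank_def vec_space.col_space_def by simp
qed

lemma mult_vec_image_smult:
  fixes A :: "'a :: field mat"
  assumes A: "A \<in> carrier_mat n m" and "c \<noteq> 0"
  shows "(*\<^sub>v) (c \<cdot>\<^sub>m A) ` carrier_vec m = (*\<^sub>v) A ` carrier_vec m"
proof -
  have *: "c \<cdot>\<^sub>m A *\<^sub>v v = A *\<^sub>v (c \<cdot>\<^sub>v v)" if "v \<in> carrier_vec m" for v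
    using A that by (intro eq_vecI) (auto simp: scalar_prod_def sum_distrib_left mult_ac)
  show ?thesis
  proof (intro equalityI subsetI)
    fix w assume "w \<in> (*\<^sub>v) (c \<cdot>\<^sub>m A) ` carrier_vec m"
    then show "w \<in> (*\<^sub>v) A ` carrier_vec m" using * by force
  next
    fix w assume "w \<in> (*\<^sub>v) A ` carrier_vec m"
    then obtain v where v: "v \<in> carrier_vec m" "w = A *\<^sub>v v" by blast
    have "c \<cdot>\<^sub>v (inverse c \<cdot>\<^sub>v v) = v" using \<open>c \<noteq> 0\<close> by (simp add: smult_smult_assoc)
    then show "w \<in> (*\<^sub>v) (c \<cdot>\<^sub>m A) ` carrier_vec m"
      using v *[of "inverse c \<cdot>\<^sub>v v"] by (intro image_eqI[of _ _ "inverse c \<cdot>\<^sub>v v"]) simp_all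
  qed
qed

lemma rank_smult:
  fixes A :: "'a :: field mat"
  assumes A: "A \<in> carrier_mat n m" and "c \<noteq> 0"
  shows "vec_space.rank n (c \<cdot>\<^sub>m A) = vec_space.rank n A"
  using assms by (intro rank_eqI_image[of _ _ m _ m] mult_vec_image_smult) auto

lemma left_invertible_rank:
  fixes F :: "'a :: field mat"
  assumes F: "F \<in> carrier_mat n m" and B: "B \<in> carrier_mat m n" and BF: "B * F = 1\<^sub>m m"
  shows "vec_space.rank n F = m"
proof -
  interpret vec_space "TYPE('a)" n .
  have inj: "x = B *\<^sub>v (F *\<^sub>v x)" if "x \<in> carrier_vec m" for x
    using that by (simp add: assoc_mult_mat_vec[OF B F that, symmetric] BF)
  \<comment> \<open>Linear independence concerns the set of columns, in which equal columns would
    collapse; hence distinctness comes first.\<close>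
  have dist: "distinct (cols F)"
  proof (unfold distinct_conv_nth, intro allI impI)
    fix i j assume ij: "i < length (cols F)" "j < length (cols F)" "i \<noteq> j"
    then have "i < m" "j < m" using F by auto
    then have "F *\<^sub>v unit_vec m i \<noteq> F *\<^sub>v unit_vec m j"
      using inj[of "unit_vec m i"] inj[of "unit_vec m j"] unit_vec_eq[of i m j] ij(3) by auto
    then show "cols F ! i \<noteq> cols F ! j"
      using ij F \<open>i < m\<close> \<open>j < m\<close> by (simp add: mat_mult_unit_vec[of F n m])
  qed
  have "lin_indpt (set (cols F))"
  proof
    assume "lin_dep (set (cols F))"
    from lin_depE[OF F this dist] obtain v
      where "v \<in> carrier_vec m" "v \<noteq> 0\<^sub>v m" "F *\<^sub>v v = 0\<^sub>v n" .
    then show False using inj[of v] B by auto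
  qed
  then show ?thesis using lin_indpt_full_rank[OF F dist] by simp
qed

text \<open>\<open>U\<close> is an isometry \<open>F\<close> onto the image of \<open>P\<close>, and
  \<open>W\<close> is the adjoint of \<open>F\<close> times \<open>P\<close>. An idempotent fixes
  its image, so P F = F and W U = 1; and \<open>F\<close> times its adjoint fixes the image of
  \<open>P\<close>, so U W = P.\<close>

lemma idempotent_rank_factorization:
  fixes P :: "complex mat"
  assumes P: "P \<in> carrier_mat n n" and PP: "P * P = P"
  obtains U W where "U \<in> carrier_mat n (vec_space.rank n P)" "W \<in> carrier_mat (vec_space.rank n P) n"
    "W * U = 1\<^sub>m (vec_space.rank n P)" "U * W = P"
proof -
  obtain m F where F: "F \<in> carrier_mat n m" and FF: "mat_adjoint F * F = 1\<^sub>m m"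
    and img: "(*\<^sub>v) P ` carrier_vec n = (*\<^sub>v) F ` carrier_vec m"
    using subspace_isometry[OF mult_vec_image_subspace[OF P]] .
  note Fa = mat_adjoint_carrier[OF F]
  have rank: "vec_space.rank n P = m"
    using rank_eqI_image[OF P F img] left_invertible_rank[OF F Fa FF] by simp
  have PF: "P * F = F"
  proof (rule mat_eqI_mult_vec[of _ n m])
    fix v :: "complex vec" assume v: "v \<in> carrier_vec m"
    then obtain x where x: "x \<in> carrier_vec n" "F *\<^sub>v v = P *\<^sub>v x" using img by blast
    then have "P *\<^sub>v (F *\<^sub>v v) = P * P *\<^sub>v x" using P by simp
    then show "P * F *\<^sub>v v = F *\<^sub>v v" using v x P F PP by simp
  qed (use P F in auto)
  have FFP: "F * (mat_adjoint F * P) = P"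
  proof (rule mat_eqI_mult_vec[of _ n n])
    fix v :: "complex vec" assume v: "v \<in> carrier_vec n"
    then obtain x where x: "x \<in> carrier_vec m" "P *\<^sub>v v = F *\<^sub>v x" using img by blast
    have "F * (mat_adjoint F * P) *\<^sub>v v = F *\<^sub>v (mat_adjoint F *\<^sub>v (F *\<^sub>v x))"
      unfolding assoc_mult_mat_vec[OF F mult_carrier_mat[OF Fa P] v] assoc_mult_mat_vec[OF Fa P v] x(2) ..
    also have "\<dots> = P *\<^sub>v v" using x by (simp add: assoc_mult_mat_vec[OF Fa F x(1), symmetric] FF)
    finally show "F * (mat_adjoint F * P) *\<^sub>v v = P *\<^sub>v v" .
  qed (use P F in auto)
  have "mat_adjoint F * P * F = mat_adjoint F * (P * F)" by (rule assoc_mult_mat[OF Fa P F])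
  then have "mat_adjoint F * P * F = 1\<^sub>m m" using PF FF by simp
  then show thesis using that F Fa P FFP unfolding rank by (meson mult_carrier_mat)
qed

section \<open>Schur's lemma and orthogonality\<close>

lemma unitary_repD:
  assumes "unitary_rep G \<rho>"
  shows "g \<in> carrier G \<Longrightarrow> \<rho> g \<in> carrier_mat (rep_dim G \<rho>) (rep_dim G \<rho>)"
    "g \<in> carrier G \<Longrightarrow> mat_adjoint (\<rho> g) * \<rho> g = 1\<^sub>m (rep_dim G \<rho>)"
    "g \<in> carrier G \<Longrightarrow> h \<in> carrier G \<Longrightarrow> \<rho> (g \<otimes>\<^bsub>G\<^esub> h) = \<rho> g * \<rho> h"
  using assms by (auto simp: unitary_rep_def)

lemma rep_mult_index:
  assumes "unitary_rep G \<rho>" "g \<in> carrier G" "h \<in> carrier G" "i < rep_dim G \<rho>" "j < rep_dim G \<rho>"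
  shows "\<rho> (g \<otimes>\<^bsub>G\<^esub> h) $$ (i, j) = (\<Sum>l<rep_dim G \<rho>. \<rho> g $$ (i, l) * \<rho> h $$ (l, j))"
  using assms unitary_repD(1)[OF assms(1), of g] unitary_repD(1)[OF assms(1), of h]
  by (simp add: unitary_repD(3)[OF assms(1-3)] scalar_prod_def atLeast0LessThan)

text \<open>\<open>unitary_rep\<close> does not postulate this: \<rho>(1) is idempotent and has its
  adjoint as a left inverse, which cancels one factor.\<close>

lemma (in group) rep_one:
  assumes "unitary_rep G \<rho>"
  shows "\<rho> \<one> = 1\<^sub>m (rep_dim G \<rho>)"
proof -
  note C = unitary_repD(1)[OF assms one_closed]
  have idem: "\<rho> \<one> * \<rho> \<one> = \<rho> \<one>" using unitary_repD(3)[OF assms one_closed one_closed] by simp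
  have "mat_adjoint (\<rho> \<one>) * (\<rho> \<one> * \<rho> \<one>) = mat_adjoint (\<rho> \<one>) * \<rho> \<one> * \<rho> \<one>"
    by (rule assoc_mult_mat[OF mat_adjoint_carrier[OF C] C C, symmetric])
  then show ?thesis using C unitary_repD(2)[OF assms one_closed] by (simp add: idem)
qed

text \<open>The relation with \<open>B\<close> makes the image of \<open>A\<close> invariant, so a
  nonzero \<open>A\<close> is surjective; the columns of \<open>X\<close> are preimages of the unit
  vectors. This is the surjective half of Schur's lemma.\<close>

lemma irreducible_image:
  assumes irr: "irreducible_rep G \<rho>" and A: "A \<in> carrier_mat (rep_dim G \<rho>) m"
    and C: "\<And>g. g \<in> carrier G \<Longrightarrow> \<rho> g \<in> carrier_mat (rep_dim G \<rho>) (rep_dim G \<rho>)"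
    and inv: "\<And>g. g \<in> carrier G \<Longrightarrow> \<exists>B\<in>carrier_mat m m. \<rho> g * A = A * B"
    and nz: "A \<noteq> 0\<^sub>m (rep_dim G \<rho>) m"
  obtains X where "X \<in> carrier_mat m (rep_dim G \<rho>)" "A * X = 1\<^sub>m (rep_dim G \<rho>)"
proof -
  let ?d = "rep_dim G \<rho>" and ?W = "(*\<^sub>v) A ` carrier_vec m"
  have "\<rho> g *\<^sub>v w \<in> ?W" if g: "g \<in> carrier G" and w: "w \<in> ?W" for g w
  proof -
    obtain B where B: "B \<in> carrier_mat m m" "\<rho> g * A = A * B" using inv[OF g] by blast
    obtain x where x: "x \<in> carrier_vec m" "w = A *\<^sub>v x" using w by blast
    have "\<rho> g *\<^sub>v w = A *\<^sub>v (B *\<^sub>v x)"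
      unfolding x(2) assoc_mult_mat_vec[OF C[OF g] A x(1), symmetric] B(2)
      by (rule assoc_mult_mat_vec[OF A B(1) x(1)])
    then show ?thesis using B x by auto
  qed
  then have "?W = {0\<^sub>v ?d} \<or> ?W = carrier_vec ?d"
    using irr mult_vec_image_subspace[OF A] unfolding irreducible_rep_def by blast
  moreover have "?W \<noteq> {0\<^sub>v ?d}"
  proof
    assume zero: "?W = {0\<^sub>v ?d}"
    have "A = 0\<^sub>m ?d m"
    proof (rule mat_eqI_mult_vec[OF A])
      fix v :: "complex vec" assume v: "v \<in> carrier_vec m"
      then have "A *\<^sub>v v = 0\<^sub>v ?d" using zero by blast
      then show "A *\<^sub>v v = 0\<^sub>m ?d m *\<^sub>v v" using v by (auto intro!: eq_vecI)
    qed simp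
    then show False using nz by simp
  qed
  ultimately have full: "?W = carrier_vec ?d" by blast
  have "\<exists>x\<in>carrier_vec m. A *\<^sub>v x = unit_vec ?d j" for j
    using full unit_vec_carrier[of ?d j] by (metis (no_types, lifting) imageE)
  then obtain f where f: "\<And>j. f j \<in> carrier_vec m" "\<And>j. A *\<^sub>v f j = unit_vec ?d j" by metis
  define X where "X = mat m ?d (\<lambda>(i, j). f j $ i)"
  have X: "X \<in> carrier_mat m ?d" by (simp add: X_def)
  have "A * X = 1\<^sub>m ?d"
  proof (rule mat_col_eqI)
    fix j assume "j < dim_col (1\<^sub>m ?d :: complex mat)"
    then have j: "j < ?d" by simp
    have "col X j = f j" using j f(1)[of j] by (intro eq_vecI) (auto simp: X_def)
    then show "col (A * X) j = col (1\<^sub>m ?d) j" using j f by (simp add: col_mult2[OF A X])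
  qed (use A X in auto)
  then show thesis using that X by blast
qed

text \<open>The injective half of Schur's lemma: the kernel of \<open>A\<close> is invariant and, as
  \<open>A\<close> is nonzero, not the whole space.\<close>

lemma irreducible_kernel:
  assumes irr: "irreducible_rep G \<rho>" and A: "A \<in> carrier_mat m (rep_dim G \<rho>)"
    and C: "\<And>g. g \<in> carrier G \<Longrightarrow> \<rho> g \<in> carrier_mat (rep_dim G \<rho>) (rep_dim G \<rho>)"
    and inv: "\<And>g. g \<in> carrier G \<Longrightarrow> \<exists>B\<in>carrier_mat m m. A * \<rho> g = B * A"
    and nz: "A \<noteq> 0\<^sub>m m (rep_dim G \<rho>)"
    and v: "v \<in> carrier_vec (rep_dim G \<rho>)" "A *\<^sub>v v = 0\<^sub>v m"
  shows "v = 0\<^sub>v (rep_dim G \<rho>)"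
proof -
  let ?d = "rep_dim G \<rho>"
  let ?W = "{v \<in> carrier_vec ?d. A *\<^sub>v v = 0\<^sub>v m}"
  have sub: "VectorSpace.subspace class_ring ?W (module_vec TYPE(complex) ?d)"
    using A by (intro subspace_module_vecI) (auto simp: mult_add_distrib_mat_vec[OF A] mult_mat_vec[OF A])
  have "\<rho> g *\<^sub>v w \<in> ?W" if g: "g \<in> carrier G" and w: "w \<in> ?W" for g w
  proof -
    obtain B where B: "B \<in> carrier_mat m m" "A * \<rho> g = B * A" using inv[OF g] by blast
    from w have x: "w \<in> carrier_vec ?d" "A *\<^sub>v w = 0\<^sub>v m" by auto
    have "A *\<^sub>v (\<rho> g *\<^sub>v w) = B *\<^sub>v (A *\<^sub>v w)"
      unfolding assoc_mult_mat_vec[OF A C[OF g] x(1), symmetric] B(2)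
      by (rule assoc_mult_mat_vec[OF B(1) A x(1)])
    then show ?thesis using B C[OF g] x by auto
  qed
  then have "?W = {0\<^sub>v ?d} \<or> ?W = carrier_vec ?d"
    using irr sub unfolding irreducible_rep_def by blast
  moreover have "?W \<noteq> carrier_vec ?d"
  proof
    assume full: "?W = carrier_vec ?d"
    have "A = 0\<^sub>m m ?d"
    proof (rule mat_eqI_mult_vec[OF A])
      fix v :: "complex vec" assume v: "v \<in> carrier_vec ?d"
      then have "A *\<^sub>v v = 0\<^sub>v m" using full by blast
      then show "A *\<^sub>v v = 0\<^sub>m m ?d *\<^sub>v v" using v by (auto intro!: eq_vecI)
    qed simp
    then show False using nz by simp
  qed
  ultimately show ?thesis using v by blast
qed

text \<open>Surjectivity comes from irreducibility of \<rho> and injectivity from that of \<sigma>.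
  Injectivity is kept as a separate conclusion because \<open>schur_scalar\<close> applies it to an
  eigenvector.\<close>

lemma schur_nonzero_invertible:
  assumes \<rho>: "unitary_rep G \<rho>" "irreducible_rep G \<rho>" and \<sigma>: "unitary_rep G \<sigma>" "irreducible_rep G \<sigma>"
    and M: "M \<in> carrier_mat (rep_dim G \<rho>) (rep_dim G \<sigma>)"
    and inter: "\<And>g. g \<in> carrier G \<Longrightarrow> \<rho> g * M = M * \<sigma> g"
    and nz: "M \<noteq> 0\<^sub>m (rep_dim G \<rho>) (rep_dim G \<sigma>)"
  shows "invertible_mat M"
    and "\<And>v. v \<in> carrier_vec (rep_dim G \<sigma>) \<Longrightarrow> M *\<^sub>v v = 0\<^sub>v (rep_dim G \<rho>) \<Longrightarrow> v = 0\<^sub>v (rep_dim G \<sigma>)"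
proof -
  let ?d = "rep_dim G \<rho>" and ?e = "rep_dim G \<sigma>"
  obtain X where X: "X \<in> carrier_mat ?e ?d" and MX: "M * X = 1\<^sub>m ?d"
    using irreducible_image[OF \<rho>(2) M unitary_repD(1)[OF \<rho>(1)] _ nz]
      inter unitary_repD(1)[OF \<sigma>(1)] by metis
  show ker: "v = 0\<^sub>v ?e" if "v \<in> carrier_vec ?e" "M *\<^sub>v v = 0\<^sub>v ?d" for v
    using irreducible_kernel[OF \<sigma>(2) M unitary_repD(1)[OF \<sigma>(1)] _ nz that]
      inter unitary_repD(1)[OF \<rho>(1)] by metis
  \<comment> \<open>The right inverse is also a left inverse: \<open>M\<close> sends X M v and v to
    the same vector and is injective.\<close>
  have XM: "X * M = 1\<^sub>m ?e"
  proof (rule mat_eqI_mult_vec[of _ ?e ?e])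
    fix v :: "complex vec" assume v: "v \<in> carrier_vec ?e"
    define w where "w = X *\<^sub>v (M *\<^sub>v v)"
    have w: "w \<in> carrier_vec ?e" using X M v by (simp add: w_def)
    have "M *\<^sub>v w = M * X *\<^sub>v (M *\<^sub>v v)" unfolding w_def using X M v by (simp add: assoc_mult_mat_vec[OF M X])
    then have "M *\<^sub>v w = M *\<^sub>v v" using M v by (simp add: MX)
    then have "M *\<^sub>v (w - v) = 0\<^sub>v ?d"
      unfolding mult_minus_distrib_mat_vec[OF M w v] using M v by simp
    then have "w - v = 0\<^sub>v ?e" using ker[of "w - v"] w v by simp
    moreover have "w = (w - v) + v" using w v by (intro eq_vecI) auto
    ultimately have "w = v" using v by simp
    then show "X * M *\<^sub>v v = 1\<^sub>m ?e *\<^sub>v v" using v by (simp add: w_def assoc_mult_mat_vec[OF X M])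
  qed (use X M in auto)
  have "?d = ?e" using right_inverse_dim_le[OF M X MX] right_inverse_dim_le[OF X M XM] by simp
  then show "invertible_mat M"
    using M X MX XM unfolding invertible_mat_def square_mat.simps inverts_mat_def by auto
qed

text \<open>Subtracting an eigenvalue leaves an intertwiner that kills an eigenvector, so the
  difference is zero. An eigenvalue exists because the dimension is positive.\<close>

lemma schur_scalar:
  assumes \<rho>: "unitary_rep G \<rho>" "irreducible_rep G \<rho>"
    and M: "M \<in> carrier_mat (rep_dim G \<rho>) (rep_dim G \<rho>)"
    and inter: "\<And>g. g \<in> carrier G \<Longrightarrow> \<rho> g * M = M * \<rho> g"
  obtains c where "M = c \<cdot>\<^sub>m 1\<^sub>m (rep_dim G \<rho>)"
proof -
  let ?d = "rep_dim G \<rho>"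
  have d: "?d > 0" using \<rho>(2) by (simp add: irreducible_rep_def)
  obtain c where "eigenvalue M c" using spectrum_non_empty[OF M] d by (auto simp: spectrum_def)
  then obtain v where v: "v \<in> carrier_vec ?d" "v \<noteq> 0\<^sub>v ?d" "M *\<^sub>v v = c \<cdot>\<^sub>v v"
    using M unfolding eigenvalue_def eigenvector_def by auto
  define N where "N = M - c \<cdot>\<^sub>m 1\<^sub>m ?d"
  have N: "N \<in> carrier_mat ?d ?d" unfolding N_def by (intro minus_carrier_mat) simp
  have "N *\<^sub>v v = M *\<^sub>v v - c \<cdot>\<^sub>m 1\<^sub>m ?d *\<^sub>v v"
    unfolding N_def using M v by (intro minus_mult_distrib_mat_vec) auto
  also have "c \<cdot>\<^sub>m 1\<^sub>m ?d *\<^sub>v v = c \<cdot>\<^sub>v v"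
    using v by (intro eq_vecI) auto
  finally have Nv: "N *\<^sub>v v = 0\<^sub>v ?d" using v by simp
  have "\<rho> g * N = N * \<rho> g" if g: "g \<in> carrier G" for g
  proof -
    note C = unitary_repD(1)[OF \<rho>(1) g]
    have "\<rho> g * N = \<rho> g * M - \<rho> g * (c \<cdot>\<^sub>m 1\<^sub>m ?d)"
      unfolding N_def using C M by (intro mult_minus_distrib_mat) auto
    also have "\<dots> = M * \<rho> g - (c \<cdot>\<^sub>m 1\<^sub>m ?d) * \<rho> g"
      using C inter[OF g] by (simp add: mult_smult_distrib[OF C one_carrier_mat] mult_smult_assoc_mat[OF one_carrier_mat C])
    also have "\<dots> = N * \<rho> g"
      unfolding N_def using C M by (intro minus_mult_distrib_mat[symmetric]) auto
    finally show ?thesis .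
  qed
  from schur_nonzero_invertible(2)[OF \<rho> \<rho> N this _ v(1) Nv] v(2)
  have "N = 0\<^sub>m ?d ?d" by blast
  moreover have "M = N + c \<cdot>\<^sub>m 1\<^sub>m ?d" using M by (intro eq_matI) (auto simp: N_def)
  ultimately have "M = c \<cdot>\<^sub>m 1\<^sub>m ?d" by (metis left_add_zero_mat one_carrier_mat smult_carrier_mat)
  then show thesis by (rule that)
qed

text \<open>Averaging the matrix unit at \<open>(a, b)\<close> over the group gives an intertwiner.\<close>

lemma (in group) average_intertwines:
  assumes \<rho>: "unitary_rep G \<rho>" and \<sigma>: "unitary_rep G \<sigma>"
    and a: "a < rep_dim G \<rho>" and b: "b < rep_dim G \<sigma>" and h: "h \<in> carrier G"
  defines "M \<equiv> mat (rep_dim G \<rho>) (rep_dim G \<sigma>) (\<lambda>(i, k). \<Sum>g\<in>carrier G. \<rho> (inv g) $$ (i, a) * \<sigma> g $$ (b, k))"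
  shows "\<rho> h * M = M * \<sigma> h"
proof (rule eq_matI)
  note C = unitary_repD(1)[OF \<rho> h] unitary_repD(1)[OF \<sigma> h]
  fix i k assume "i < dim_row (M * \<sigma> h)" "k < dim_col (M * \<sigma> h)"
  then have i: "i < rep_dim G \<rho>" and k: "k < rep_dim G \<sigma>" using C by (auto simp: M_def)
  have bij: "bij_betw (\<lambda>g. g \<otimes> h) (carrier G) (carrier G)"
    using h by (intro bij_betw_byWitness[where f' = "\<lambda>g. g \<otimes> inv h"]) (auto simp: m_assoc)
  have "(\<rho> h * M) $$ (i, k) = (\<Sum>l<rep_dim G \<rho>. \<rho> h $$ (i, l) * (\<Sum>g\<in>carrier G. \<rho> (inv g) $$ (l, a) * \<sigma> g $$ (b, k)))"
    using i k C by (simp add: M_def scalar_prod_def atLeast0LessThan)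
  also have "\<dots> = (\<Sum>g\<in>carrier G. (\<Sum>l<rep_dim G \<rho>. \<rho> h $$ (i, l) * \<rho> (inv g) $$ (l, a)) * \<sigma> g $$ (b, k))"
    unfolding sum_distrib_left sum_distrib_right by (subst sum.swap) (simp add: mult.assoc)
  also have "\<dots> = (\<Sum>g\<in>carrier G. \<rho> (h \<otimes> inv g) $$ (i, a) * \<sigma> g $$ (b, k))"
    using rep_mult_index[OF \<rho> h inv_closed i a] by (intro sum.cong) auto
  \<comment> \<open>Replacing g by g h turns h (g h)^-1 into g^-1, which moves \<open>h\<close> from
    the left factor into the right one.\<close>
  also have "\<dots> = (\<Sum>g\<in>carrier G. \<rho> (h \<otimes> inv (g \<otimes> h)) $$ (i, a) * \<sigma> (g \<otimes> h) $$ (b, k))"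
    using sum.reindex_bij_betw[OF bij, of "\<lambda>g. \<rho> (h \<otimes> inv g) $$ (i, a) * \<sigma> g $$ (b, k)"] by simp
  also have "\<dots> = (\<Sum>g\<in>carrier G. \<rho> (inv g) $$ (i, a) * (\<Sum>l<rep_dim G \<sigma>. \<sigma> g $$ (b, l) * \<sigma> h $$ (l, k)))"
    using h rep_mult_index[OF \<sigma> _ h b k]
    by (intro sum.cong) (auto simp: inv_mult_group m_assoc[symmetric])
  also have "\<dots> = (\<Sum>l<rep_dim G \<sigma>. (\<Sum>g\<in>carrier G. \<rho> (inv g) $$ (i, a) * \<sigma> g $$ (b, l)) * \<sigma> h $$ (l, k))"
    unfolding sum_distrib_left sum_distrib_right by (subst sum.swap) (simp add: mult.assoc)
  also have "\<dots> = (M * \<sigma> h) $$ (i, k)"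
    using i k C by (simp add: M_def scalar_prod_def atLeast0LessThan)
  finally show "(\<rho> h * M) $$ (i, k) = (M * \<sigma> h) $$ (i, k)" .
qed (use unitary_repD(1)[OF \<rho> h] unitary_repD(1)[OF \<sigma> h] in \<open>auto simp: M_def\<close>)

text \<open>The sum is an entry of the averaged intertwiner, which maps the space of \<sigma> to
  that of \<rho>; hence the direction of \<open>equivalent_reps G \<sigma> \<rho>\<close>. By Schur
  it vanishes.\<close>

lemma (in group) schur_orthogonality_distinct:
  assumes \<rho>: "unitary_rep G \<rho>" "irreducible_rep G \<rho>" and \<sigma>: "unitary_rep G \<sigma>" "irreducible_rep G \<sigma>"
    and neq: "\<not> equivalent_reps G \<sigma> \<rho>"
    and ik: "i < rep_dim G \<rho>" "a < rep_dim G \<rho>" "b < rep_dim G \<sigma>" "k < rep_dim G \<sigma>"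
  shows "(\<Sum>g\<in>carrier G. \<rho> (inv g) $$ (i, a) * \<sigma> g $$ (b, k)) = 0"
proof -
  define M where "M = mat (rep_dim G \<rho>) (rep_dim G \<sigma>)
    (\<lambda>(i, k). \<Sum>g\<in>carrier G. \<rho> (inv g) $$ (i, a) * \<sigma> g $$ (b, k))"
  have M: "M \<in> carrier_mat (rep_dim G \<rho>) (rep_dim G \<sigma>)" by (simp add: M_def)
  have inter: "\<rho> h * M = M * \<sigma> h" if "h \<in> carrier G" for h
    unfolding M_def by (rule average_intertwines[OF \<rho>(1) \<sigma>(1) ik(2,3) that])
  have "M = 0\<^sub>m (rep_dim G \<rho>) (rep_dim G \<sigma>)"
  proof (rule ccontr)
    assume "M \<noteq> 0\<^sub>m (rep_dim G \<rho>) (rep_dim G \<sigma>)"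
    from schur_nonzero_invertible(1)[OF \<rho> \<sigma> M inter this]
    have "equivalent_reps G \<sigma> \<rho>" unfolding equivalent_reps_def using M inter by metis
    then show False using neq by simp
  qed
  from arg_cong[OF this, of "\<lambda>M. M $$ (i, k)"] show ?thesis using ik by (simp add: M_def)
qed

text \<open>The averaged intertwiner is a scalar c, read off its trace: d c is the sum over g of the
  entry (b, a) of \<rho>(g g^-1), that is |G| or 0.\<close>

lemma (in group) schur_orthogonality_same:
  assumes \<rho>: "unitary_rep G \<rho>" "irreducible_rep G \<rho>"
    and ik: "i < rep_dim G \<rho>" "a < rep_dim G \<rho>" "b < rep_dim G \<rho>" "k < rep_dim G \<rho>"
  shows "(\<Sum>g\<in>carrier G. \<rho> (inv g) $$ (i, a) * \<rho> g $$ (b, k))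
    = of_bool (i = k \<and> a = b) * of_nat (card (carrier G)) / of_nat (rep_dim G \<rho>)"
proof -
  let ?d = "rep_dim G \<rho>"
  define M where "M = mat ?d ?d (\<lambda>(i, k). \<Sum>g\<in>carrier G. \<rho> (inv g) $$ (i, a) * \<rho> g $$ (b, k))"
  have M: "M \<in> carrier_mat ?d ?d" by (simp add: M_def)
  have inter: "\<rho> h * M = M * \<rho> h" if "h \<in> carrier G" for h
    unfolding M_def by (rule average_intertwines[OF \<rho>(1) \<rho>(1) ik(2,3) that])
  obtain c where c: "M = c \<cdot>\<^sub>m 1\<^sub>m ?d" using schur_scalar[OF \<rho> M inter] .
  have entry: "(\<Sum>g\<in>carrier G. \<rho> (inv g) $$ (i, a) * \<rho> g $$ (b, k)) = c * of_bool (i = k)"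
    if "i < ?d" "k < ?d" for i k
    using arg_cong[OF c, of "\<lambda>M. M $$ (i, k)"] that by (simp add: M_def)
  have "of_nat ?d * c = (\<Sum>i<?d. \<Sum>g\<in>carrier G. \<rho> (inv g) $$ (i, a) * \<rho> g $$ (b, i))"
    using entry by simp
  also have "\<dots> = (\<Sum>g\<in>carrier G. \<Sum>i<?d. \<rho> g $$ (b, i) * \<rho> (inv g) $$ (i, a))"
    by (subst sum.swap) (simp add: mult.commute)
  also have "\<dots> = (\<Sum>g\<in>carrier G. \<rho> (g \<otimes> inv g) $$ (b, a))"
    by (intro sum.cong) (simp_all add: rep_mult_index[OF \<rho>(1) _ _ ik(3,2), symmetric])
  also have "\<dots> = of_bool (a = b) * of_nat (card (carrier G))"
    using ik rep_one[OF \<rho>(1)] by simp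
  finally have "c = of_bool (a = b) * of_nat (card (carrier G)) / of_nat ?d"
    using \<rho>(2) by (simp add: irreducible_rep_def field_simps)
  then show ?thesis using entry[OF ik(1,4)] by (cases "i = k"; cases "a = b") simp_all
qed

text \<open>The (0, 0) coefficients of the members of \<open>Irep\<close> form an orthogonal family
  of functions on G, so there are at most |G| of them. Finiteness matters, since a sum over an
  infinite set is 0 by convention.\<close>

lemma (in group) finite_complete_unitary_irreps:
  assumes fin: "finite (carrier G)" and Irep: "complete_unitary_irreps G Irep"
  shows "finite Irep"
proof (rule ccontr)
  assume "infinite Irep"
  then obtain S where S: "finite S" "card S = Suc (card (carrier G))" "S \<subseteq> Irep"
    using infinite_arbitrarily_large by blast
  have irr: "unitary_rep G \<rho>" "irreducible_rep G \<rho>" "0 < rep_dim G \<rho>" if "\<rho> \<in> S" for \<rho>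
    using that S Irep by (auto simp: complete_unitary_irreps_def irreducible_rep_def)
  have "card S \<le> card (carrier G)"
  proof (rule right_inverse_card_le[OF S(1) fin])
    fix \<rho> \<sigma> assume \<rho>: "\<rho> \<in> S" and \<sigma>: "\<sigma> \<in> S"
    have sum: "(\<Sum>g\<in>carrier G. \<rho> (inv g) $$ (0, 0) * \<sigma> g $$ (0, 0))
        = of_bool (\<rho> = \<sigma>) * of_nat (card (carrier G)) / of_nat (rep_dim G \<rho>)"
    proof (cases "\<rho> = \<sigma>")
      case True
      then show ?thesis using schur_orthogonality_same[OF irr(1,2)[OF \<rho>]] irr(3)[OF \<rho>] by simp
    next
      case False
      then have "\<not> equivalent_reps G \<sigma> \<rho>"
        using \<rho> \<sigma> S Irep unfolding complete_unitary_irreps_def by blast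
      with False show ?thesis
        using schur_orthogonality_distinct[OF irr(1,2)[OF \<rho>] irr(1,2)[OF \<sigma>]] irr(3)[OF \<rho>] irr(3)[OF \<sigma>]
        by simp
    qed
    have "card (carrier G) > 0" using fin by (auto simp: card_gt_0_iff)
    then show "(\<Sum>g\<in>carrier G. (of_nat (rep_dim G \<rho>) / of_nat (card (carrier G)) * \<rho> (inv g) $$ (0, 0)) * \<sigma> g $$ (0, 0))
        = of_bool (\<rho> = \<sigma>)"
      using irr(3)[OF \<rho>] unfolding mult.assoc sum_distrib_left[symmetric] sum by simp
  qed
  then show False using S by simp
qed

section \<open>Irreducible representations inside unitary ones\<close>

text \<open>\<open>F\<close> times its adjoint is the identity on the image of \<open>F\<close>, and
  \<open>A\<close> maps that image into itself. The bracket on the right is \<open>A\<close>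
  restricted to the image, in the coordinates given by \<open>F\<close>.\<close>

lemma isometry_invariant:
  fixes F :: "complex mat"
  assumes F: "F \<in> carrier_mat n m" and FF: "mat_adjoint F * F = 1\<^sub>m m" and A: "A \<in> carrier_mat n n"
    and inv: "\<And>v. v \<in> (*\<^sub>v) F ` carrier_vec m \<Longrightarrow> A *\<^sub>v v \<in> (*\<^sub>v) F ` carrier_vec m"
  shows "A * F = F * (mat_adjoint F * A * F)"
proof (rule mat_eqI_mult_vec[of _ n m])
  note Fa = mat_adjoint_carrier[OF F]
  note AF = mult_carrier_mat[OF A F]
  fix v :: "complex vec" assume v: "v \<in> carrier_vec m"
  then obtain x where x: "x \<in> carrier_vec m" "A *\<^sub>v (F *\<^sub>v v) = F *\<^sub>v x" using inv by blast
  have AFv: "A * F *\<^sub>v v = F *\<^sub>v x" using x assoc_mult_mat_vec[OF A F v] by simp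
  have "mat_adjoint F * A * F *\<^sub>v v = mat_adjoint F *\<^sub>v (A * F *\<^sub>v v)"
    unfolding assoc_mult_mat[OF Fa A F] by (rule assoc_mult_mat_vec[OF Fa AF v])
  also have "\<dots> = x" unfolding AFv assoc_mult_mat_vec[OF Fa F x(1), symmetric] FF using x by simp
  finally have "mat_adjoint F * A * F *\<^sub>v v = x" .
  then show "A * F *\<^sub>v v = F * (mat_adjoint F * A * F) *\<^sub>v v"
    unfolding AFv assoc_mult_mat_vec[OF F mult_carrier_mat[OF mult_carrier_mat[OF Fa A] F] v] by simp
qed (use F A in auto)

text \<open>
  An isometry onto an invariant subspace with the least positive number of columns carries an
  irreducible representation.
\<close>

lemma (in group) invariant_subspace_contains_irrep:
  assumes Irep: "complete_unitary_irreps G Irep" and R: "unitary_rep G R"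
    and W: "VectorSpace.subspace class_ring W (module_vec TYPE(complex) (rep_dim G R))"
    and inv: "\<And>g w. g \<in> carrier G \<Longrightarrow> w \<in> W \<Longrightarrow> R g *\<^sub>v w \<in> W"
    and nz: "W \<noteq> {0\<^sub>v (rep_dim G R)}"
  obtains \<rho> E where "\<rho> \<in> Irep" "E \<in> carrier_mat (rep_dim G R) (rep_dim G \<rho>)"
    "E \<noteq> 0\<^sub>m (rep_dim G R) (rep_dim G \<rho>)"
    "\<And>g. g \<in> carrier G \<Longrightarrow> R g * E = E * \<rho> g" "(*\<^sub>v) E ` carrier_vec (rep_dim G \<rho>) \<subseteq> W"
proof -
  let ?n = "rep_dim G R"
  note C = unitary_repD(1)[OF R]
  \<comment> \<open>The last conjunct states invariance of the column space as a matrix identity; 0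
    < d excludes the zero subspace.\<close>
  define Q where "Q d \<longleftrightarrow> 0 < d \<and> (\<exists>E\<in>carrier_mat ?n d. mat_adjoint E * E = 1\<^sub>m d \<and>
      (*\<^sub>v) E ` carrier_vec d \<subseteq> W \<and> (\<forall>g\<in>carrier G. R g * E = E * (mat_adjoint E * R g * E)))" for d
  obtain m0 F0 where F0: "F0 \<in> carrier_mat ?n m0" "mat_adjoint F0 * F0 = 1\<^sub>m m0"
    "W = (*\<^sub>v) F0 ` carrier_vec m0" using subspace_isometry[OF W] .
  have "m0 \<noteq> 0"
  proof
    assume "m0 = 0"
    then have "F0 *\<^sub>v v = 0\<^sub>v ?n" if "v \<in> carrier_vec m0" for v
      using that F0 by (intro eq_vecI) (auto simp: scalar_prod_def)
    then have "W \<subseteq> {0\<^sub>v ?n}" using F0(3) by auto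
    then show False using nz subspace_module_vecD(2)[OF W] by auto
  qed
  moreover have "R g * F0 = F0 * (mat_adjoint F0 * R g * F0)" if "g \<in> carrier G" for g
    using inv[OF that] unfolding F0(3) by (rule isometry_invariant[OF F0(1,2) C[OF that]])
  ultimately have "Q m0" unfolding Q_def using F0 by blast
  define d where "d = (LEAST d. Q d)"
  have "Q d" unfolding d_def by (rule LeastI[of Q, OF \<open>Q m0\<close>])
  have least: "d \<le> m" if "Q m" for m unfolding d_def by (rule Least_le[of Q, OF that])
  from \<open>Q d\<close> obtain E where d: "0 < d" and E: "E \<in> carrier_mat ?n d" and EE: "mat_adjoint E * E = 1\<^sub>m d"
    and EW: "(*\<^sub>v) E ` carrier_vec d \<subseteq> W"
    and ER: "\<And>g. g \<in> carrier G \<Longrightarrow> R g * E = E * (mat_adjoint E * R g * E)"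
    unfolding Q_def by blast
  note Ea = mat_adjoint_carrier[OF E]
  \<comment> \<open>The restriction of \<open>R\<close> in the coordinates of \<open>E\<close>.
    Since \<open>E\<close> can be cancelled on the left, E \<sigma>(g) = R(g) E transfers unitarity
    and multiplicativity from \<open>R\<close> to \<sigma>.\<close>
  define \<sigma> where "\<sigma> g = mat_adjoint E * R g * E" for g
  have \<sigma>C: "\<sigma> g \<in> carrier_mat d d" if "g \<in> carrier G" for g
    unfolding \<sigma>_def by (rule mult_carrier_mat[OF mult_carrier_mat[OF Ea C[OF that]] E])
  have E\<sigma>: "R g * E = E * \<sigma> g" if "g \<in> carrier G" for g unfolding \<sigma>_def by (rule ER[OF that])
  have cancel: "mat_adjoint E * (E * X) = X" if "X \<in> carrier_mat d k" for X k
    using that by (simp add: assoc_mult_mat[OF Ea E that, symmetric] EE)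
  have dim: "rep_dim G \<sigma> = d" using \<sigma>C[OF one_closed] by (simp add: rep_dim_def)
  have \<sigma>: "unitary_rep G \<sigma>"
    unfolding unitary_rep_def dim
  proof (intro conjI ballI)
    fix g assume g: "g \<in> carrier G"
    show "\<sigma> g \<in> carrier_mat d d" by (rule \<sigma>C[OF g])
    note \<sigma>a = mat_adjoint_carrier[OF \<sigma>C[OF g]] and Ra = mat_adjoint_carrier[OF C[OF g]]
    have RE: "R g * E \<in> carrier_mat ?n d" by (rule mult_carrier_mat[OF C[OF g] E])
    have "mat_adjoint (E * \<sigma> g) * (E * \<sigma> g) = mat_adjoint (\<sigma> g) * (mat_adjoint E * (E * \<sigma> g))"
      unfolding mat_adjoint_mult[OF E \<sigma>C[OF g]]
      by (rule assoc_mult_mat[OF \<sigma>a Ea mult_carrier_mat[OF E \<sigma>C[OF g]]])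
    then have "mat_adjoint (\<sigma> g) * \<sigma> g = mat_adjoint (R g * E) * (R g * E)"
      unfolding E\<sigma>[OF g] by (simp add: cancel[OF \<sigma>C[OF g]])
    also have "\<dots> = mat_adjoint E * (mat_adjoint (R g) * (R g * E))"
      unfolding mat_adjoint_mult[OF C[OF g] E] by (rule assoc_mult_mat[OF Ea Ra RE])
    also have "mat_adjoint (R g) * (R g * E) = E"
      using E by (simp add: assoc_mult_mat[OF Ra C[OF g] E, symmetric] unitary_repD(2)[OF R g])
    finally show "mat_adjoint (\<sigma> g) * \<sigma> g = 1\<^sub>m d" by (simp add: EE)
  next
    fix g h assume g: "g \<in> carrier G" and h: "h \<in> carrier G"
    have "E * \<sigma> (g \<otimes> h) = R g * R h * E"
      using E\<sigma>[OF m_closed[OF g h]] unitary_repD(3)[OF R g h] by simp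
    also have "\<dots> = R g * (R h * E)" by (rule assoc_mult_mat[OF C[OF g] C[OF h] E])
    also have "\<dots> = R g * E * \<sigma> h"
      unfolding E\<sigma>[OF h] by (rule assoc_mult_mat[OF C[OF g] E \<sigma>C[OF h], symmetric])
    also have "\<dots> = E * (\<sigma> g * \<sigma> h)"
      unfolding E\<sigma>[OF g] by (rule assoc_mult_mat[OF E \<sigma>C[OF g] \<sigma>C[OF h]])
    finally have "mat_adjoint E * (E * \<sigma> (g \<otimes> h)) = mat_adjoint E * (E * (\<sigma> g * \<sigma> h))" by simp
    then show "\<sigma> (g \<otimes> h) = \<sigma> g * \<sigma> h"
      by (simp only: cancel[OF \<sigma>C[OF m_closed[OF g h]]] cancel[OF mult_carrier_mat[OF \<sigma>C[OF g] \<sigma>C[OF h]]])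
  qed
  have "irreducible_rep G \<sigma>"
    unfolding irreducible_rep_def dim
  proof (intro conjI allI impI)
    fix X assume X: "VectorSpace.subspace class_ring X (module_vec TYPE(complex) d) \<and>
        (\<forall>g\<in>carrier G. \<forall>w\<in>X. \<sigma> g *\<^sub>v w \<in> X)"
    obtain m F where F: "F \<in> carrier_mat d m" and FF: "mat_adjoint F * F = 1\<^sub>m m"
      and FX: "X = (*\<^sub>v) F ` carrier_vec m" using subspace_isometry[OF conjunct1[OF X]] .
    note Fa = mat_adjoint_carrier[OF F]
    \<comment> \<open>An invariant subspace of \<sigma> is carried by \<open>E\<close> to an
      invariant subspace of \<open>R\<close> inside \<open>W\<close>, with isometry E F; so E F
      competes with \<open>E\<close> for the least number of columns.\<close>
    have EF: "E * F \<in> carrier_mat ?n m" by (rule mult_carrier_mat[OF E F])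
    have EFEF: "mat_adjoint (E * F) * (E * F) = 1\<^sub>m m"
      unfolding mat_adjoint_mult[OF E F] assoc_mult_mat[OF Fa Ea EF] by (simp add: cancel[OF F] FF)
    show "X = {0\<^sub>v d} \<or> X = carrier_vec d"
    proof (cases "m = 0")
      case True
      then have "F *\<^sub>v v = 0\<^sub>v d" if "v \<in> carrier_vec m" for v
        using that F by (intro eq_vecI) (auto simp: scalar_prod_def)
      then have "X \<subseteq> {0\<^sub>v d}" using FX by auto
      then show ?thesis using subspace_module_vecD(2)[OF conjunct1[OF X]] by blast
    next
      case False
      have "R g * (E * F) = E * F * (mat_adjoint (E * F) * R g * (E * F))" if g: "g \<in> carrier G" for g
      proof (rule isometry_invariant[OF EF EFEF C[OF g]])
        fix w assume "w \<in> (*\<^sub>v) (E * F) ` carrier_vec m"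
        then obtain v where v: "v \<in> carrier_vec m" "w = E * F *\<^sub>v v" by blast
        have Fv: "F *\<^sub>v v \<in> carrier_vec d" using F v by simp
        have "R g *\<^sub>v w = R g * E *\<^sub>v (F *\<^sub>v v)"
          unfolding v(2) assoc_mult_mat_vec[OF E F v(1)]
          by (rule assoc_mult_mat_vec[OF C[OF g] E Fv, symmetric])
        also have "\<dots> = E *\<^sub>v (\<sigma> g *\<^sub>v (F *\<^sub>v v))"
          unfolding E\<sigma>[OF g] by (rule assoc_mult_mat_vec[OF E \<sigma>C[OF g] Fv])
        finally have "R g *\<^sub>v w = E *\<^sub>v (\<sigma> g *\<^sub>v (F *\<^sub>v v))" .
        moreover have "\<sigma> g *\<^sub>v (F *\<^sub>v v) \<in> X" using X g v FX by blast
        then obtain u where "u \<in> carrier_vec m" "\<sigma> g *\<^sub>v (F *\<^sub>v v) = F *\<^sub>v u" using FX by blast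
        ultimately show "R g *\<^sub>v w \<in> (*\<^sub>v) (E * F) ` carrier_vec m"
          using assoc_mult_mat_vec[OF E F] by (intro image_eqI[of _ _ u]) simp_all
      qed
      moreover have "(*\<^sub>v) (E * F) ` carrier_vec m \<subseteq> W"
      proof
        fix w assume "w \<in> (*\<^sub>v) (E * F) ` carrier_vec m"
        then obtain v where v: "v \<in> carrier_vec m" "w = E *\<^sub>v (F *\<^sub>v v)"
          using assoc_mult_mat_vec[OF E F] by auto
        then have "F *\<^sub>v v \<in> carrier_vec d" using F by simp
        then show "w \<in> W" using EW v(2) by blast
      qed
      ultimately have "Q m" unfolding Q_def using False EF EFEF by blast
      then have "m = d" using least right_inverse_dim_le[OF Fa F FF] by (simp add: order_antisym)
      \<comment> \<open>With m = d the isometry \<open>F\<close> is square, hence unitary, and its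
        image \<open>X\<close> is everything.\<close>
      then have "F * mat_adjoint F = 1\<^sub>m d"
        using mat_mult_left_right_inverse[of "mat_adjoint F" d F] F Fa FF by simp
      then have "v \<in> X" if "v \<in> carrier_vec d" for v
        using that assoc_mult_mat_vec[OF F Fa that] Fa unfolding FX
        by (intro image_eqI[of _ _ "mat_adjoint F *\<^sub>v v"]) auto
      then show ?thesis using subspace_module_vecD(1)[OF conjunct1[OF X]] by blast
    qed
  qed (rule d)
  \<comment> \<open>Passing to the chosen member of the equivalence class replaces \<open>E\<close>
    by E T. This need not be an isometry, so only that it is nonzero is retained.\<close>
  then obtain \<rho> where \<rho>: "\<rho> \<in> Irep" and "equivalent_reps G \<rho> \<sigma>"
    using Irep \<sigma> unfolding complete_unitary_irreps_def by blast
  then obtain T where T: "T \<in> carrier_mat d (rep_dim G \<rho>)" "invertible_mat T"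
    and T\<rho>: "\<And>g. g \<in> carrier G \<Longrightarrow> T * \<rho> g = \<sigma> g * T"
    unfolding equivalent_reps_def dim by blast
  have \<rho>C: "\<rho> g \<in> carrier_mat (rep_dim G \<rho>) (rep_dim G \<rho>)" if "g \<in> carrier G" for g
    using Irep \<rho> that by (auto simp: complete_unitary_irreps_def intro: unitary_repD)
  have ET: "E * T \<in> carrier_mat ?n (rep_dim G \<rho>)" by (rule mult_carrier_mat[OF E T(1)])
  show thesis
  proof (rule that[OF \<rho> ET])
    show "E * T \<noteq> 0\<^sub>m ?n (rep_dim G \<rho>)"
    proof
      assume "E * T = 0\<^sub>m ?n (rep_dim G \<rho>)"
      then have "T = 0\<^sub>m d (rep_dim G \<rho>)" using cancel[OF T(1)] right_mult_zero_mat[OF Ea] by simp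
      moreover obtain B where "T * B = 1\<^sub>m (dim_row T)" and BT: "B * T = 1\<^sub>m (dim_row B)"
        using T(2) unfolding invertible_mat_def inverts_mat_def by blast
      ultimately have zero: "0\<^sub>m d (rep_dim G \<rho>) * B = 1\<^sub>m d" using T(1) by simp
      have "dim_row B = rep_dim G \<rho>" using arg_cong[OF BT, of dim_col] T(1) by simp
      moreover have "dim_col B = d" using arg_cong[OF zero, of dim_col] by simp
      ultimately show False
        using arg_cong[OF zero, of "\<lambda>M. M $$ (0, 0)"] d by (simp add: scalar_prod_def)
    qed
    show "R g * (E * T) = E * T * \<rho> g" if g: "g \<in> carrier G" for g
    proof -
      have "R g * (E * T) = E * \<sigma> g * T"
        unfolding E\<sigma>[OF g, symmetric] by (rule assoc_mult_mat[OF C[OF g] E T(1), symmetric])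
      also have "\<dots> = E * (\<sigma> g * T)" by (rule assoc_mult_mat[OF E \<sigma>C[OF g] T(1)])
      also have "\<dots> = E * T * \<rho> g"
        unfolding T\<rho>[OF g, symmetric] by (rule assoc_mult_mat[OF E T(1) \<rho>C[OF g], symmetric])
      finally show ?thesis .
    qed
    show "(*\<^sub>v) (E * T) ` carrier_vec (rep_dim G \<rho>) \<subseteq> W"
    proof
      fix w assume "w \<in> (*\<^sub>v) (E * T) ` carrier_vec (rep_dim G \<rho>)"
      then obtain v where v: "v \<in> carrier_vec (rep_dim G \<rho>)" "w = E *\<^sub>v (T *\<^sub>v v)"
        using assoc_mult_mat_vec[OF E T(1)] by auto
      then have "T *\<^sub>v v \<in> carrier_vec d" using T(1) by simp
      then show "w \<in> W" using EW v(2) by blast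
    qed
  qed
qed

section \<open>Decomposition of the coset representation\<close>

locale finite_coset_space = group G for G (structure) +
  fixes H :: "'a set" and Irep :: "('a \<Rightarrow> complex mat) set"
  assumes finite_carrier: "finite (carrier G)"
    and subgroup_H: "subgroup H G"
    and complete_Irep: "complete_unitary_irreps G Irep"
begin

section \<open>Right cosets and sums over them\<close>

lemma H_subset: "H \<subseteq> carrier G"
  by (rule subgroup.subset[OF subgroup_H])

lemma finite_H: "finite H"
  using finite_subset[OF H_subset finite_carrier] .

lemma card_H_pos: "card H > 0"
  using finite_H subgroup.one_closed[OF subgroup_H] by (auto simp: card_gt_0_iff)

lemma finite_cosets: "finite (rcosets H)"
  using finite_carrier rcosets_part_G[OF subgroup_H] by (metis finite_UnionD)

lemma coset_carrier: "J \<in> rcosets H \<Longrightarrow> J \<subseteq> carrier G"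
  using rcosets_part_G[OF subgroup_H] by blast

lemma coset_mult_closed: "J \<in> rcosets H \<Longrightarrow> g \<in> carrier G \<Longrightarrow> J #> g \<in> rcosets H"
  using H_subset by (auto simp: RCOSETS_def coset_mult_assoc)

lemma coset_mult_mult: "J \<in> rcosets H \<Longrightarrow> g \<in> carrier G \<Longrightarrow> h \<in> carrier G \<Longrightarrow> J #> g #> h = J #> (g \<otimes> h)"
  by (rule coset_mult_assoc[OF coset_carrier])

lemma bij_betw_coset_mult:
  assumes "g \<in> carrier G"
  shows "bij_betw (\<lambda>J. J #> g) (rcosets H) (rcosets H)"
  using assms
  by (intro bij_betw_byWitness[where f' = "\<lambda>J. J #> inv g"])
    (auto simp: coset_mult_mult coset_mult_closed coset_mult_one coset_carrier)

text \<open>Functions on cosets are evaluated at a representative; their invariance under left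
  translation by H makes the choice immaterial.\<close>

definition coset_repr :: "'a set \<Rightarrow> 'a" where "coset_repr J = (SOME g. g \<in> J)"

lemma coset_repr:
  assumes "J \<in> rcosets H"
  shows "coset_repr J \<in> carrier G" "J = H #> coset_repr J" "coset_repr J \<in> J"
proof -
  show in_J: "coset_repr J \<in> J" unfolding coset_repr_def
    using subgroup.rcosets_non_empty[OF subgroup_H assms] by (simp add: some_in_eq)
  then show "coset_repr J \<in> carrier G" using coset_carrier[OF assms] by blast
  obtain g where "g \<in> carrier G" "J = H #> g" using assms by (auto simp: RCOSETS_def)
  then show "J = H #> coset_repr J" using repr_independence[OF _ _ subgroup_H] in_J by blast
qed

text \<open>Each coset contributes |H| equal terms. This carries Schur orthogonality from G over to
  the cosets.\<close>

lemma sum_carrier_eq_sum_cosets: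
  fixes f :: "'a \<Rightarrow> complex"
  assumes "\<And>h g. h \<in> H \<Longrightarrow> g \<in> carrier G \<Longrightarrow> f (h \<otimes> g) = f g"
  shows "(\<Sum>g\<in>carrier G. f g) = of_nat (card H) * (\<Sum>J\<in>rcosets H. f (coset_repr J))"
proof -
  have const: "f g = f (coset_repr J)" if "J \<in> rcosets H" "g \<in> J" for J g
  proof -
    have "g \<in> H #> coset_repr J" using coset_repr(2)[OF that(1)] that(2) by simp
    then obtain h where "h \<in> H" "g = h \<otimes> coset_repr J" by (auto simp: r_coset_def)
    then show ?thesis using assms coset_repr(1)[OF that(1)] by simp
  qed
  have "(\<Sum>g\<in>carrier G. f g) = (\<Sum>g\<in>\<Union>(rcosets H). f g)" using rcosets_part_G[OF subgroup_H] by simp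
  also have "\<dots> = (\<Sum>J\<in>rcosets H. \<Sum>g\<in>J. f g)"
    using rcos_disjoint[OF subgroup_H] finite_subset[OF coset_carrier finite_carrier]
    by (subst sum.Union_disjoint) (auto simp: pairwise_def disjnt_def)
  also have "\<dots> = (\<Sum>J\<in>rcosets H. of_nat (card H) * f (coset_repr J))"
  proof (rule sum.cong[OF refl])
    fix J assume J: "J \<in> rcosets H"
    have "(\<Sum>g\<in>J. f g) = (\<Sum>g\<in>J. f (coset_repr J))" by (rule sum.cong[OF refl const[OF J]])
    also have "\<dots> = of_nat (card H) * f (coset_repr J)"
      using card_rcosets_equal[OF J H_subset] by simp
    finally show "(\<Sum>g\<in>J. f g) = of_nat (card H) * f (coset_repr J)" .
  qed
  finally show ?thesis by (simp add: sum_distrib_left)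
qed

lemma Irep_props:
  assumes "\<rho> \<in> Irep"
  shows "unitary_rep G \<rho>" "irreducible_rep G \<rho>" "0 < rep_dim G \<rho>"
  using assms complete_Irep by (auto simp: complete_unitary_irreps_def irreducible_rep_def)

section \<open>Multiplicities and the projection onto the H-fixed vectors\<close>

definition isotypic_mult :: "('a \<Rightarrow> complex mat) \<Rightarrow> nat" where
  "isotypic_mult \<rho> = vec_space.rank (rep_dim G \<rho>) (rep_subset_sum G \<rho> H)"

lemma rep_subset_sum_carrier:
  "rep_subset_sum G \<rho> S \<in> carrier_mat (rep_dim G \<rho>) (rep_dim G \<rho>)"
  by (simp add: rep_subset_sum_def rep_alg_def)

lemma rep_subset_sum_index:
  assumes "i < rep_dim G \<rho>" "j < rep_dim G \<rho>"
  shows "rep_subset_sum G \<rho> H $$ (i, j) = (\<Sum>h\<in>H. \<rho> h $$ (i, j))"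
  unfolding rep_subset_sum_def using rep_alg_sum_single[OF finite_H assms, of "\<lambda>h. h"] by simp

text \<open>Translation by \<open>h\<close>, on either side, permutes H.\<close>

lemma rep_subset_sum_absorb:
  assumes \<rho>: "\<rho> \<in> Irep" and h: "h \<in> H"
  shows "\<rho> h * rep_subset_sum G \<rho> H = rep_subset_sum G \<rho> H" (is ?left)
    and "rep_subset_sum G \<rho> H * \<rho> h = rep_subset_sum G \<rho> H" (is ?right)
proof -
  note S = rep_subset_sum_carrier[of \<rho> H] and index = rep_subset_sum_index[of _ \<rho>]
  have hG: "h \<in> carrier G" using h H_subset by blast
  note C = unitary_repD(1)[OF Irep_props(1)[OF \<rho>] hG]
  note mult = rep_mult_index[OF Irep_props(1)[OF \<rho>]]
  interpret H: subgroup H G by (rule subgroup_H)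
  show ?left
  proof (rule eq_matI, goal_cases)
    case (1 i j)
    then have ij: "i < rep_dim G \<rho>" "j < rep_dim G \<rho>" using S by auto
    have "(\<rho> h * rep_subset_sum G \<rho> H) $$ (i, j) = (\<Sum>l<rep_dim G \<rho>. \<rho> h $$ (i, l) * (\<Sum>x\<in>H. \<rho> x $$ (l, j)))"
      using ij C S by (simp add: scalar_prod_def atLeast0LessThan index)
    also have "\<dots> = (\<Sum>x\<in>H. \<rho> (h \<otimes> x) $$ (i, j))"
      unfolding sum_distrib_left using H_subset
      by (subst sum.swap) (auto intro!: sum.cong mult[OF hG _ ij, symmetric])
    also have "\<dots> = (\<Sum>x\<in>H. \<rho> x $$ (i, j))"
    proof (rule sum.reindex_bij_betw)
      show "bij_betw (\<lambda>x. h \<otimes> x) H H"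
        using h by (intro bij_betw_byWitness[where f' = "\<lambda>x. inv h \<otimes> x"]) (auto simp: m_assoc[symmetric])
    qed
    finally show ?case using ij by (simp add: index)
  qed (use S C in auto)
  show ?right
  proof (rule eq_matI, goal_cases)
    case (1 i j)
    then have ij: "i < rep_dim G \<rho>" "j < rep_dim G \<rho>" using S by auto
    have "(rep_subset_sum G \<rho> H * \<rho> h) $$ (i, j) = (\<Sum>l<rep_dim G \<rho>. (\<Sum>x\<in>H. \<rho> x $$ (i, l)) * \<rho> h $$ (l, j))"
      using ij C S by (simp add: scalar_prod_def atLeast0LessThan index)
    also have "\<dots> = (\<Sum>x\<in>H. \<rho> (x \<otimes> h) $$ (i, j))"
      unfolding sum_distrib_right using H_subset
      by (subst sum.swap) (auto intro!: sum.cong mult[OF _ hG ij, symmetric])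
    also have "\<dots> = (\<Sum>x\<in>H. \<rho> x $$ (i, j))"
    proof (rule sum.reindex_bij_betw)
      show "bij_betw (\<lambda>x. x \<otimes> h) H H"
        using h by (intro bij_betw_byWitness[where f' = "\<lambda>x. x \<otimes> inv h"]) (auto simp: m_assoc)
    qed
    finally show ?case using ij by (simp add: index)
  qed (use S C in auto)
qed

definition proj :: "('a \<Rightarrow> complex mat) \<Rightarrow> complex mat" where
  "proj \<rho> = (1 / of_nat (card H)) \<cdot>\<^sub>m rep_subset_sum G \<rho> H"

lemma proj_carrier: "proj \<rho> \<in> carrier_mat (rep_dim G \<rho>) (rep_dim G \<rho>)"
  by (simp add: proj_def rep_subset_sum_carrier)

lemma proj_absorb:
  assumes "\<rho> \<in> Irep" "h \<in> H"
  shows "\<rho> h * proj \<rho> = proj \<rho>" "proj \<rho> * \<rho> h = proj \<rho>"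
proof -
  have C: "\<rho> h \<in> carrier_mat (rep_dim G \<rho>) (rep_dim G \<rho>)"
    using assms H_subset by (intro unitary_repD(1) Irep_props) auto
  show "\<rho> h * proj \<rho> = proj \<rho>" "proj \<rho> * \<rho> h = proj \<rho>"
    unfolding proj_def mult_smult_distrib[OF C rep_subset_sum_carrier]
      mult_smult_assoc_mat[OF rep_subset_sum_carrier C] rep_subset_sum_absorb[OF assms] by simp_all
qed

lemma proj_index:
  assumes "i < rep_dim G \<rho>" "j < rep_dim G \<rho>"
  shows "proj \<rho> $$ (i, j) = (\<Sum>h\<in>H. \<rho> h $$ (i, j)) / of_nat (card H)"
  using assms rep_subset_sum_carrier[of \<rho> H] by (simp add: proj_def rep_subset_sum_index)

text \<open>The product is the average over H of \<rho>(h) P, and each of these terms is P.\<close>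

lemma proj_idem:
  assumes \<rho>: "\<rho> \<in> Irep"
  shows "proj \<rho> * proj \<rho> = proj \<rho>"
proof (rule eq_matI, goal_cases)
  case (1 i j)
  note P = proj_carrier[of \<rho>]
  from 1 have ij: "i < rep_dim G \<rho>" "j < rep_dim G \<rho>" using P by auto
  have C: "\<rho> h \<in> carrier_mat (rep_dim G \<rho>) (rep_dim G \<rho>)" if "h \<in> H" for h
    using that H_subset \<rho> by (intro unitary_repD(1) Irep_props) auto
  have "(proj \<rho> * proj \<rho>) $$ (i, j) = (\<Sum>l<rep_dim G \<rho>. (\<Sum>h\<in>H. \<rho> h $$ (i, l)) / of_nat (card H) * proj \<rho> $$ (l, j))"
    using ij P by (simp add: scalar_prod_def atLeast0LessThan proj_index)
  also have "\<dots> = (\<Sum>h\<in>H. \<Sum>l<rep_dim G \<rho>. \<rho> h $$ (i, l) * proj \<rho> $$ (l, j)) / of_nat (card H)"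
    unfolding sum_distrib_right sum_divide_distrib by (subst sum.swap) simp
  also have "\<dots> = (\<Sum>h\<in>H. (\<rho> h * proj \<rho>) $$ (i, j)) / of_nat (card H)"
  proof -
    have "(\<Sum>l<rep_dim G \<rho>. \<rho> h $$ (i, l) * proj \<rho> $$ (l, j)) = (\<rho> h * proj \<rho>) $$ (i, j)" if "h \<in> H" for h
      using ij P C[OF that] by (simp add: scalar_prod_def atLeast0LessThan)
    then show ?thesis by simp
  qed
  also have "\<dots> = proj \<rho> $$ (i, j)" using card_H_pos by (simp add: proj_absorb[OF \<rho>])
  finally show ?case .
qed (use proj_carrier[of \<rho>] in auto)

text \<open>The scalar 1/|H| does not change the rank, so the inner dimension is exactly the rank of
  \<rho>(H).\<close>

lemma proj_factorization:
  assumes \<rho>: "\<rho> \<in> Irep"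
  obtains U W where "U \<in> carrier_mat (rep_dim G \<rho>) (isotypic_mult \<rho>)" "W \<in> carrier_mat (isotypic_mult \<rho>) (rep_dim G \<rho>)"
    "W * U = 1\<^sub>m (isotypic_mult \<rho>)" "U * W = proj \<rho>"
proof -
  have "vec_space.rank (rep_dim G \<rho>) (proj \<rho>) = isotypic_mult \<rho>"
    unfolding proj_def isotypic_mult_def using card_H_pos by (intro rank_smult[OF rep_subset_sum_carrier]) simp
  then show thesis
    using idempotent_rank_factorization[OF proj_carrier proj_idem[OF \<rho>]] that by metis
qed

text \<open>Both factors are chosen together because the two product identities tie them to each
  other.\<close>

definition factors :: "('a \<Rightarrow> complex mat) \<Rightarrow> complex mat \<times> complex mat" where
  "factors \<rho> = (SOME (U, W). U \<in> carrier_mat (rep_dim G \<rho>) (isotypic_mult \<rho>) \<and>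
     W \<in> carrier_mat (isotypic_mult \<rho>) (rep_dim G \<rho>) \<and>
     W * U = 1\<^sub>m (isotypic_mult \<rho>) \<and> U * W = proj \<rho>)"

abbreviation "left_factor \<rho> \<equiv> fst (factors \<rho>)"
abbreviation "right_factor \<rho> \<equiv> snd (factors \<rho>)"

lemma factors:
  assumes "\<rho> \<in> Irep"
  shows "left_factor \<rho> \<in> carrier_mat (rep_dim G \<rho>) (isotypic_mult \<rho>)"
    "right_factor \<rho> \<in> carrier_mat (isotypic_mult \<rho>) (rep_dim G \<rho>)"
    "right_factor \<rho> * left_factor \<rho> = 1\<^sub>m (isotypic_mult \<rho>)"
    "left_factor \<rho> * right_factor \<rho> = proj \<rho>"
proof -
  let ?Q = "\<lambda>(U, W). U \<in> carrier_mat (rep_dim G \<rho>) (isotypic_mult \<rho>) \<and>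
     W \<in> carrier_mat (isotypic_mult \<rho>) (rep_dim G \<rho>) \<and>
     W * U = 1\<^sub>m (isotypic_mult \<rho>) \<and> U * W = proj \<rho>"
  obtain U W where "U \<in> carrier_mat (rep_dim G \<rho>) (isotypic_mult \<rho>)"
    "W \<in> carrier_mat (isotypic_mult \<rho>) (rep_dim G \<rho>)"
    "W * U = 1\<^sub>m (isotypic_mult \<rho>)" "U * W = proj \<rho>"
    using proj_factorization[OF assms] .
  then have "?Q (U, W)" by simp
  then have "?Q (factors \<rho>)" unfolding factors_def by (rule someI[of ?Q])
  then show "left_factor \<rho> \<in> carrier_mat (rep_dim G \<rho>) (isotypic_mult \<rho>)"
    "right_factor \<rho> \<in> carrier_mat (isotypic_mult \<rho>) (rep_dim G \<rho>)"
    "right_factor \<rho> * left_factor \<rho> = 1\<^sub>m (isotypic_mult \<rho>)"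
    "left_factor \<rho> * right_factor \<rho> = proj \<rho>"
    by (auto simp: case_prod_beta)
qed

text \<open>From W U = 1 and U W = P follow P U = U and W P = W, so the factors inherit absorption
  from P.\<close>

lemma factors_absorb:
  assumes \<rho>: "\<rho> \<in> Irep" and h: "h \<in> H"
  shows "\<rho> h * left_factor \<rho> = left_factor \<rho>" "right_factor \<rho> * \<rho> h = right_factor \<rho>"
proof -
  note U = factors(1)[OF \<rho>] and W = factors(2)[OF \<rho>] and WU = factors(3)[OF \<rho>] and UW = factors(4)[OF \<rho>]
  have C: "\<rho> h \<in> carrier_mat (rep_dim G \<rho>) (rep_dim G \<rho>)"
    using \<rho> h H_subset by (intro unitary_repD(1) Irep_props) auto
  have PU: "proj \<rho> * left_factor \<rho> = left_factor \<rho>"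
    unfolding UW[symmetric] assoc_mult_mat[OF U W U] WU using U by simp
  have WP: "right_factor \<rho> * proj \<rho> = right_factor \<rho>"
    unfolding UW[symmetric] assoc_mult_mat[OF W U W, symmetric] WU using W by simp
  have "\<rho> h * (proj \<rho> * left_factor \<rho>) = proj \<rho> * left_factor \<rho>"
    unfolding assoc_mult_mat[OF C proj_carrier U, symmetric] proj_absorb[OF \<rho> h] ..
  then show "\<rho> h * left_factor \<rho> = left_factor \<rho>" unfolding PU .
  have "right_factor \<rho> * proj \<rho> * \<rho> h = right_factor \<rho> * proj \<rho>"
    unfolding assoc_mult_mat[OF W proj_carrier C] proj_absorb[OF \<rho> h] ..
  then show "right_factor \<rho> * \<rho> h = right_factor \<rho>" unfolding WP .
qed

section \<open>H-invariant matrix coefficients and the change of basis\<close>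

definition right_coeff :: "('a \<Rightarrow> complex mat) \<Rightarrow> nat \<Rightarrow> nat \<Rightarrow> 'a \<Rightarrow> complex" where
  "right_coeff \<rho> j i g = (\<Sum>a<rep_dim G \<rho>. right_factor \<rho> $$ (j, a) * \<rho> g $$ (a, i))"

text \<open>Entry (i, j) of \<rho>(g^-1) U. The inverse makes it invariant under left translation by
  H, because \<rho>((h g)^-1) U = \<rho>(g^-1) \<rho>(h^-1) U.\<close>

definition left_coeff :: "('a \<Rightarrow> complex mat) \<Rightarrow> nat \<Rightarrow> nat \<Rightarrow> 'a \<Rightarrow> complex" where
  "left_coeff \<rho> i j g = (\<Sum>a<rep_dim G \<rho>. \<rho> (inv g) $$ (i, a) * left_factor \<rho> $$ (a, j))"

lemma right_coeff_mult:
  assumes "\<rho> \<in> Irep" "i < rep_dim G \<rho>" "g \<in> carrier G" "x \<in> carrier G"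
  shows "right_coeff \<rho> j i (g \<otimes> x) = (\<Sum>l<rep_dim G \<rho>. right_coeff \<rho> j l g * \<rho> x $$ (l, i))"
proof -
  have "right_coeff \<rho> j i (g \<otimes> x)
      = (\<Sum>a<rep_dim G \<rho>. \<Sum>l<rep_dim G \<rho>. right_factor \<rho> $$ (j, a) * (\<rho> g $$ (a, l) * \<rho> x $$ (l, i)))"
    unfolding right_coeff_def using rep_mult_index[OF Irep_props(1)[OF assms(1)] assms(3,4) _ assms(2)]
    by (simp add: sum_distrib_left)
  then show ?thesis
    unfolding right_coeff_def sum_distrib_right by (subst sum.swap) (simp add: mult.assoc)
qed

lemma left_coeff_mult:
  assumes "\<rho> \<in> Irep" "i < rep_dim G \<rho>" "g \<in> carrier G" "x \<in> carrier G"
  shows "left_coeff \<rho> i j (g \<otimes> inv x) = (\<Sum>l<rep_dim G \<rho>. \<rho> x $$ (i, l) * left_coeff \<rho> l j g)"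
proof -
  have "left_coeff \<rho> i j (g \<otimes> inv x)
      = (\<Sum>a<rep_dim G \<rho>. \<Sum>l<rep_dim G \<rho>. \<rho> x $$ (i, l) * \<rho> (inv g) $$ (l, a) * left_factor \<rho> $$ (a, j))"
    unfolding left_coeff_def
    using rep_mult_index[OF Irep_props(1)[OF assms(1)] assms(4) inv_closed[OF assms(3)] assms(2)] assms(3,4)
    by (simp add: sum_distrib_right inv_mult_group)
  then show ?thesis
    unfolding left_coeff_def sum_distrib_left by (subst sum.swap) (simp add: mult.assoc)
qed

lemma right_coeff_H:
  assumes \<rho>: "\<rho> \<in> Irep" and j: "j < isotypic_mult \<rho>" and i: "i < rep_dim G \<rho>"
    and h: "h \<in> H" and g: "g \<in> carrier G"
  shows "right_coeff \<rho> j i (h \<otimes> g) = right_coeff \<rho> j i g"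
proof -
  have hG: "h \<in> carrier G" using h H_subset by blast
  note C = unitary_repD(1)[OF Irep_props(1)[OF \<rho>] hG]
  have "right_coeff \<rho> j l h = right_factor \<rho> $$ (j, l)" if "l < rep_dim G \<rho>" for l
    using arg_cong[OF factors_absorb(2)[OF \<rho> h], of "\<lambda>M. M $$ (j, l)"] that j C factors(2)[OF \<rho>]
    by (simp add: right_coeff_def scalar_prod_def atLeast0LessThan)
  then show ?thesis unfolding right_coeff_mult[OF \<rho> i hG g] by (simp add: right_coeff_def)
qed

lemma left_coeff_H:
  assumes \<rho>: "\<rho> \<in> Irep" and j: "j < isotypic_mult \<rho>" and i: "i < rep_dim G \<rho>"
    and h: "h \<in> H" and g: "g \<in> carrier G"
  shows "left_coeff \<rho> i j (h \<otimes> g) = left_coeff \<rho> i j g"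
proof -
  interpret H: subgroup H G by (rule subgroup_H)
  have hG: "h \<in> carrier G" using h H_subset by blast
  have ih: "inv h \<in> H" using h by simp
  note C = unitary_repD(1)[OF Irep_props(1)[OF \<rho>] inv_closed[OF hG]]
  have absorb: "(\<Sum>a<rep_dim G \<rho>. \<rho> (inv h) $$ (l, a) * left_factor \<rho> $$ (a, j)) = left_factor \<rho> $$ (l, j)"
    if "l < rep_dim G \<rho>" for l
    using arg_cong[OF factors_absorb(1)[OF \<rho> ih], of "\<lambda>M. M $$ (l, j)"] that j C factors(1)[OF \<rho>]
    by (simp add: scalar_prod_def atLeast0LessThan)
  have "left_coeff \<rho> i j (h \<otimes> g)
      = (\<Sum>a<rep_dim G \<rho>. \<Sum>l<rep_dim G \<rho>. \<rho> (inv g) $$ (i, l) * (\<rho> (inv h) $$ (l, a) * left_factor \<rho> $$ (a, j)))"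
    unfolding left_coeff_def
    using rep_mult_index[OF Irep_props(1)[OF \<rho>] inv_closed[OF g] inv_closed[OF hG] i] hG g
    by (simp add: sum_distrib_right inv_mult_group mult.assoc)
  also have "\<dots> = (\<Sum>l<rep_dim G \<rho>. \<rho> (inv g) $$ (i, l) * (\<Sum>a<rep_dim G \<rho>. \<rho> (inv h) $$ (l, a) * left_factor \<rho> $$ (a, j)))"
    unfolding sum_distrib_left by (rule sum.swap)
  also have "\<dots> = left_coeff \<rho> i j g" unfolding left_coeff_def using absorb by simp
  finally show ?thesis .
qed

text \<open>Schur orthogonality contracted with column \<open>j\<close> of U and a free row
  \<open>w\<close>; what survives is the entry \<open>j\<close> of w U.\<close>

lemma left_coeff_orthogonal:
  assumes \<rho>: "\<rho> \<in> Irep" and \<sigma>: "\<sigma> \<in> Irep" and i: "i < rep_dim G \<rho>" and k: "k < rep_dim G \<sigma>"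
  shows "(\<Sum>g\<in>carrier G. left_coeff \<rho> i j g * (\<Sum>b<rep_dim G \<sigma>. w b * \<sigma> g $$ (b, k)))
    = of_bool (\<rho> = \<sigma> \<and> i = k) * (of_nat (card (carrier G)) / of_nat (rep_dim G \<rho>))
      * (\<Sum>a<rep_dim G \<rho>. w a * left_factor \<rho> $$ (a, j))"
proof -
  let ?c = "of_nat (card (carrier G)) / of_nat (rep_dim G \<rho>) :: complex"
  have orth: "(\<Sum>g\<in>carrier G. \<rho> (inv g) $$ (i, a) * \<sigma> g $$ (b, k)) = of_bool (\<rho> = \<sigma> \<and> i = k) * (of_bool (a = b) * ?c)"
    if "a < rep_dim G \<rho>" "b < rep_dim G \<sigma>" for a b
  proof (cases "\<rho> = \<sigma>")
    case True
    then show ?thesis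
      using schur_orthogonality_same[OF Irep_props(1,2)[OF \<rho>] i that(1)] that k by simp
  next
    case False
    then have "\<not> equivalent_reps G \<sigma> \<rho>" using \<rho> \<sigma> complete_Irep unfolding complete_unitary_irreps_def by blast
    then show ?thesis
      using False schur_orthogonality_distinct[OF Irep_props(1,2)[OF \<rho>] Irep_props(1,2)[OF \<sigma>]] i k that
      by simp
  qed
  have "(\<Sum>g\<in>carrier G. left_coeff \<rho> i j g * (\<Sum>b<rep_dim G \<sigma>. w b * \<sigma> g $$ (b, k)))
      = (\<Sum>g\<in>carrier G. \<Sum>a<rep_dim G \<rho>. \<Sum>b<rep_dim G \<sigma>.
          left_factor \<rho> $$ (a, j) * w b * (\<rho> (inv g) $$ (i, a) * \<sigma> g $$ (b, k)))"
    unfolding left_coeff_def sum_product by (simp add: mult_ac)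
  also have "\<dots> = (\<Sum>a<rep_dim G \<rho>. \<Sum>b<rep_dim G \<sigma>. left_factor \<rho> $$ (a, j) * w b *
          (\<Sum>g\<in>carrier G. \<rho> (inv g) $$ (i, a) * \<sigma> g $$ (b, k)))"
    unfolding sum_distrib_left by (subst sum.swap, intro sum.cong refl, rule sum.swap)
  also have "\<dots> = (\<Sum>a<rep_dim G \<rho>. \<Sum>b<rep_dim G \<sigma>. left_factor \<rho> $$ (a, j) * w b *
          (of_bool (\<rho> = \<sigma> \<and> i = k) * (of_bool (a = b) * ?c)))"
    using orth by simp
  also have "\<dots> = of_bool (\<rho> = \<sigma> \<and> i = k) * ?c * (\<Sum>a<rep_dim G \<rho>. w a * left_factor \<rho> $$ (a, j))"
  proof (cases "\<rho> = \<sigma> \<and> i = k")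
    case True
    then have "\<rho> = \<sigma>" by simp
    have "(\<Sum>b<rep_dim G \<sigma>. left_factor \<rho> $$ (a, j) * w b * (of_bool (a = b) * ?c))
        = ?c * (w a * left_factor \<rho> $$ (a, j))" if "a < rep_dim G \<rho>" for a
    proof -
      have "(\<Sum>b<rep_dim G \<sigma>. left_factor \<rho> $$ (a, j) * w b * (of_bool (a = b) * ?c))
          = (\<Sum>b<rep_dim G \<sigma>. if b = a then ?c * (w a * left_factor \<rho> $$ (a, j)) else 0)"
        by (intro sum.cong) auto
      then show ?thesis using that \<open>\<rho> = \<sigma>\<close> by simp
    qed
    with True show ?thesis by (simp add: sum_distrib_left)
  qed auto
  finally show ?thesis .
qed

text \<open>A pair (\<rho>, j) names one copy of \<rho>, and \<open>i\<close> is a coordinate in it.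
  The nesting lets the copies serve as labels of diagonal blocks.\<close>

definition index_set :: "((('a \<Rightarrow> complex mat) \<times> nat) \<times> nat) set" where
  "index_set = Sigma (Sigma Irep (\<lambda>\<rho>. {..<isotypic_mult \<rho>})) (\<lambda>s. {..<rep_dim G (fst s)})"

fun decomp :: "'a set \<Rightarrow> (('a \<Rightarrow> complex mat) \<times> nat) \<times> nat \<Rightarrow> complex" where
  "decomp J ((\<rho>, j), i) = right_coeff \<rho> j i (coset_repr J)"

text \<open>The scalar is d/n with n = |G|/|H|: orthogonality over G produces |G|/d, and passing to
  cosets divides this by |H|.\<close>

fun decomp_inv :: "(('a \<Rightarrow> complex mat) \<times> nat) \<times> nat \<Rightarrow> 'a set \<Rightarrow> complex" where
  "decomp_inv ((\<rho>, j), i) J =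
     of_nat (rep_dim G \<rho>) * of_nat (card H) / of_nat (card (carrier G)) * left_coeff \<rho> i j (coset_repr J)"

lemma coset_repr_invariant:
  assumes "\<And>h g. h \<in> H \<Longrightarrow> g \<in> carrier G \<Longrightarrow> f (h \<otimes> g) = f g" and g: "g \<in> carrier G"
  shows "f (coset_repr (H #> g)) = f g"
proof -
  have "coset_repr (H #> g) \<in> H #> g" by (rule coset_repr(3)[OF rcosetsI[OF H_subset g]])
  then obtain h where "h \<in> H" "coset_repr (H #> g) = h \<otimes> g" by (auto simp: r_coset_def)
  then show ?thesis using assms by simp
qed

text \<open>Intertwining relation: W \<rho>(g x) = W \<rho>(g) \<rho>(x), so right translation of
  cosets becomes multiplication by \<rho>(x) within one copy. With x a voltage, it links the lift to
  the base matrix.\<close>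

lemma decomp_translate:
  assumes z: "((\<rho>, j), i) \<in> index_set" and J: "J \<in> rcosets H" and x: "x \<in> carrier G"
  shows "decomp (J #> x) ((\<rho>, j), i) = (\<Sum>l<rep_dim G \<rho>. decomp J ((\<rho>, j), l) * \<rho> x $$ (l, i))"
proof -
  have \<rho>: "\<rho> \<in> Irep" and j: "j < isotypic_mult \<rho>" and i: "i < rep_dim G \<rho>" using z by (auto simp: index_set_def)
  note r = coset_repr[OF J]
  have "J #> x = H #> (coset_repr J \<otimes> x)"
    using coset_mult_assoc[OF H_subset r(1) x] r(2) by simp
  then show ?thesis
    using coset_repr_invariant[of "right_coeff \<rho> j i", OF right_coeff_H[OF \<rho> j i]] r(1) x
    by (simp add: right_coeff_mult[OF \<rho> i r(1) x])
qed

text \<open>The dual relation, from \<rho>((g x^-1)^-1) U = \<rho>(x) \<rho>(g^-1) U; it makes the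
  kernel of the left inverse invariant.\<close>

lemma decomp_inv_translate:
  assumes z: "((\<rho>, j), i) \<in> index_set" and J: "J \<in> rcosets H" and x: "x \<in> carrier G"
  shows "decomp_inv ((\<rho>, j), i) (J #> inv x) = (\<Sum>l<rep_dim G \<rho>. \<rho> x $$ (i, l) * decomp_inv ((\<rho>, j), l) J)"
proof -
  have \<rho>: "\<rho> \<in> Irep" and j: "j < isotypic_mult \<rho>" and i: "i < rep_dim G \<rho>" using z by (auto simp: index_set_def)
  note r = coset_repr[OF J]
  have "J #> inv x = H #> (coset_repr J \<otimes> inv x)"
    using coset_mult_assoc[OF H_subset r(1) inv_closed[OF x]] r(2) by simp
  then show ?thesis
    using coset_repr_invariant[of "left_coeff \<rho> i j", OF left_coeff_H[OF \<rho> j i]] r(1) x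
    by (simp add: left_coeff_mult[OF \<rho> i r(1) x] sum_distrib_left mult_ac)
qed

text \<open>Both factors are constant on cosets, the second one by \<open>f\<close>, so the coset
  sum is the group sum divided by |H|.\<close>

lemma decomp_inv_orthogonal:
  assumes z: "((\<rho>, j), i) \<in> index_set" and \<sigma>: "\<sigma> \<in> Irep" and k: "k < rep_dim G \<sigma>"
    and f: "\<And>h g. h \<in> H \<Longrightarrow> g \<in> carrier G \<Longrightarrow>
      (\<Sum>b<rep_dim G \<sigma>. w b * \<sigma> (h \<otimes> g) $$ (b, k)) = (\<Sum>b<rep_dim G \<sigma>. w b * \<sigma> g $$ (b, k))"
  shows "(\<Sum>J\<in>rcosets H. decomp_inv ((\<rho>, j), i) J * (\<Sum>b<rep_dim G \<sigma>. w b * \<sigma> (coset_repr J) $$ (b, k)))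
    = of_bool (\<rho> = \<sigma> \<and> i = k) * (\<Sum>a<rep_dim G \<rho>. w a * left_factor \<rho> $$ (a, j))"
proof -
  have \<rho>: "\<rho> \<in> Irep" and j: "j < isotypic_mult \<rho>" and i: "i < rep_dim G \<rho>" using z by (auto simp: index_set_def)
  let ?n = "of_nat (card (carrier G)) :: complex" and ?d = "of_nat (rep_dim G \<rho>) :: complex"
  let ?f = "\<lambda>g. \<Sum>b<rep_dim G \<sigma>. w b * \<sigma> g $$ (b, k)"
  have n: "?n \<noteq> 0" and d: "?d \<noteq> 0" using finite_carrier Irep_props(3)[OF \<rho>] by auto
  have "(\<Sum>J\<in>rcosets H. decomp_inv ((\<rho>, j), i) J * ?f (coset_repr J))
      = ?d / ?n * (of_nat (card H) * (\<Sum>J\<in>rcosets H. left_coeff \<rho> i j (coset_repr J) * ?f (coset_repr J)))"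
    by (simp add: sum_distrib_left sum_divide_distrib mult_ac)
  also have "\<dots> = ?d / ?n * (\<Sum>g\<in>carrier G. left_coeff \<rho> i j g * ?f g)"
    by (subst sum_carrier_eq_sum_cosets[of "\<lambda>g. left_coeff \<rho> i j g * ?f g"])
      (simp_all only: left_coeff_H[OF \<rho> j i] f)
  also have "\<dots> = of_bool (\<rho> = \<sigma> \<and> i = k) * (\<Sum>a<rep_dim G \<rho>. w a * left_factor \<rho> $$ (a, j))"
    unfolding left_coeff_orthogonal[OF \<rho> \<sigma> i k] using n d by simp
  finally show ?thesis .
qed

text \<open>Here the free row is row j' of W: orthogonality separates representations and
  coordinates, and W U = 1 separates the copies.\<close>

lemma decomp_inv_decomp:
  assumes z: "z \<in> index_set" and z': "z' \<in> index_set"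
  shows "(\<Sum>J\<in>rcosets H. decomp_inv z J * decomp J z') = of_bool (z = z')"
proof -
  obtain \<rho> j i \<sigma> j' k where zz: "z = ((\<rho>, j), i)" "z' = ((\<sigma>, j'), k)" by (metis surj_pair)
  then have \<rho>: "\<rho> \<in> Irep" "j < isotypic_mult \<rho>" "i < rep_dim G \<rho>"
    and \<sigma>: "\<sigma> \<in> Irep" "j' < isotypic_mult \<sigma>" "k < rep_dim G \<sigma>"
    using z z' by (auto simp: index_set_def)
  have "(\<Sum>J\<in>rcosets H. decomp_inv z J * decomp J z')
      = of_bool (\<rho> = \<sigma> \<and> i = k) * (\<Sum>a<rep_dim G \<rho>. right_factor \<sigma> $$ (j', a) * left_factor \<rho> $$ (a, j))"
    using decomp_inv_orthogonal[OF z[unfolded zz] \<sigma>(1,3), of "\<lambda>a. right_factor \<sigma> $$ (j', a)"]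
      right_coeff_H[OF \<sigma>]
    by (simp add: zz right_coeff_def)
  also have "\<dots> = of_bool (z = z')"
  proof (cases "\<rho> = \<sigma> \<and> i = k")
    case True
    then show ?thesis
      using arg_cong[OF factors(3)[OF \<rho>(1)], of "\<lambda>M. M $$ (j', j)"] factors(1,2)[OF \<rho>(1)] \<rho> \<sigma>
      by (auto simp: zz scalar_prod_def atLeast0LessThan)
  qed (auto simp: zz)
  finally show ?thesis .
qed

lemma finite_index_set: "finite index_set"
  unfolding index_set_def
  using finite_complete_unitary_irreps[OF finite_carrier complete_Irep] by auto

section \<open>The permutation representation on cosets and the kernel of the left inverse\<close>

definition coset_rep :: "'a \<Rightarrow> complex mat" where
  "coset_rep g = mat_on (rcosets H) (\<lambda>J J'. of_bool (J #> g = J'))"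

abbreviation "index \<equiv> card (rcosets H)"

lemma rep_dim_coset_rep: "rep_dim G coset_rep = index"
  by (simp add: rep_dim_def coset_rep_def mat_on_def)

lemma coset_rep_carrier: "coset_rep g \<in> carrier_mat index index"
  unfolding coset_rep_def by (rule mat_on_carrier)

text \<open>Right translations permute the cosets. Since the row is the source coset and the column
  its translate, the product of the matrices of g and h is that of g h, in this order.\<close>

lemma unitary_coset_rep: "unitary_rep G coset_rep"
  unfolding unitary_rep_def rep_dim_coset_rep
proof (intro conjI ballI)
  fix g assume g: "g \<in> carrier G"
  show "coset_rep g \<in> carrier_mat index index" by (rule coset_rep_carrier)
  have "(\<Sum>K\<in>rcosets H. cnj (of_bool (K #> g = J)) * of_bool (K #> g = J')) = (of_bool (J = J') :: complex)"
    if J: "J \<in> rcosets H" and J': "J' \<in> rcosets H" for J J'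
  proof -
    have "(\<Sum>K\<in>rcosets H. cnj (of_bool (K #> g = J)) * of_bool (K #> g = J'))
        = (\<Sum>K\<in>rcosets H. cnj (of_bool (K = J)) * (of_bool (K = J') :: complex))"
      by (rule sum.reindex_bij_betw[OF bij_betw_coset_mult[OF g]])
    also have "\<dots> = (\<Sum>K\<in>rcosets H. if K = J then of_bool (J = J') else 0)"
      by (intro sum.cong) auto
    finally show ?thesis using J finite_cosets by simp
  qed
  then show "mat_adjoint (coset_rep g) * coset_rep g = 1\<^sub>m index"
    unfolding coset_rep_def mat_on_eq_indexed_mat mat_adjoint_indexed_mat
      indexed_mat_mult[OF finite_cosets] indexed_mat_one[OF finite_cosets, symmetric]
    by (rule indexed_mat_cong)
next
  fix g h assume g: "g \<in> carrier G" and h: "h \<in> carrier G"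
  have "(\<Sum>K\<in>rcosets H. of_bool (J #> g = K) * of_bool (K #> h = J')) = (of_bool (J #> (g \<otimes> h) = J') :: complex)"
    if J: "J \<in> rcosets H" for J J'
  proof -
    have "(\<Sum>K\<in>rcosets H. of_bool (J #> g = K) * of_bool (K #> h = J'))
        = (\<Sum>K\<in>rcosets H. if K = J #> g then (of_bool (J #> (g \<otimes> h) = J') :: complex) else 0)"
      using coset_mult_mult[OF J g h] by (intro sum.cong) auto
    then show ?thesis using coset_mult_closed[OF J g] finite_cosets by simp
  qed
  then show "coset_rep (g \<otimes> h) = coset_rep g * coset_rep h"
    unfolding coset_rep_def mat_on_eq_indexed_mat indexed_mat_mult[OF finite_cosets]
    by (intro indexed_mat_cong[symmetric])
qed

abbreviation "coset_at \<equiv> from_nat_into (rcosets H)"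

text \<open>Vectors are indexed by numbers, so the enumeration used in \<open>mat_on\<close> has to
  be inverted.\<close>

definition coset_no :: "'a set \<Rightarrow> nat" where
  "coset_no = inv_into {..<index} coset_at"

lemma coset_no:
  shows "J \<in> rcosets H \<Longrightarrow> coset_no J < index" "J \<in> rcosets H \<Longrightarrow> coset_at (coset_no J) = J"
    "l < index \<Longrightarrow> coset_at l \<in> rcosets H" "l < index \<Longrightarrow> coset_no (coset_at l) = l"
proof -
  have bij: "bij_betw coset_at {..<index} (rcosets H)" by (rule bij_betw_from_nat_into_finite[OF finite_cosets])
  show "coset_no J < index" if "J \<in> rcosets H"
    using bij_betwE[OF bij_betw_inv_into[OF bij]] that by (simp add: coset_no_def)
  show "coset_at (coset_no J) = J" if "J \<in> rcosets H"
    unfolding coset_no_def using bij that by (rule bij_betw_inv_into_right)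
  show "coset_at l \<in> rcosets H" if "l < index" using bij_betwE[OF bij] that by simp
  show "coset_no (coset_at l) = l" if "l < index"
    unfolding coset_no_def using bij that by (intro bij_betw_inv_into_left) simp_all
qed

lemma coset_rep_mult_vec:
  assumes J: "J \<in> rcosets H" and g: "g \<in> carrier G" and v: "v \<in> carrier_vec index"
  shows "(coset_rep g *\<^sub>v v) $ coset_no J = v $ coset_no (J #> g)"
proof -
  note Jg = coset_mult_closed[OF J g]
  have "(coset_rep g *\<^sub>v v) $ coset_no J = (\<Sum>l<index. of_bool (J #> g = coset_at l) * v $ l)"
    using coset_no(1,2)[OF J] v
    by (simp add: coset_rep_def mat_on_def scalar_prod_def atLeast0LessThan)
  also have "\<dots> = (\<Sum>l<index. if l = coset_no (J #> g) then v $ coset_no (J #> g) else 0)"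
    using coset_no(4) coset_no(2)[OF Jg] by (intro sum.cong) auto
  finally show ?thesis using coset_no(1)[OF Jg] by simp
qed

text \<open>The kernel of the matrix with rows \<open>decomp_inv z\<close>. A right inverse of that
  matrix is at hand; a zero kernel upgrades it to a two-sided one.\<close>

definition decomp_kernel :: "complex vec set" where
  "decomp_kernel = {v \<in> carrier_vec index. \<forall>z\<in>index_set. (\<Sum>J\<in>rcosets H. decomp_inv z J * v $ coset_no J) = 0}"

lemma subspace_decomp_kernel:
  "VectorSpace.subspace class_ring decomp_kernel (module_vec TYPE(complex) index)"
proof (rule subspace_module_vecI)
  have add: "(\<Sum>J\<in>rcosets H. decomp_inv z J * (u + v) $ coset_no J)
      = (\<Sum>J\<in>rcosets H. decomp_inv z J * u $ coset_no J) + (\<Sum>J\<in>rcosets H. decomp_inv z J * v $ coset_no J)"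
    if "u \<in> carrier_vec index" "v \<in> carrier_vec index" for u v z
    unfolding sum.distrib[symmetric] using that coset_no(1) by (intro sum.cong) (auto simp: algebra_simps)
  have smult: "(\<Sum>J\<in>rcosets H. decomp_inv z J * (c \<cdot>\<^sub>v v) $ coset_no J)
      = c * (\<Sum>J\<in>rcosets H. decomp_inv z J * v $ coset_no J)"
    if "v \<in> carrier_vec index" for v z c
    unfolding sum_distrib_left using that coset_no(1) by (intro sum.cong) (auto simp: algebra_simps)
  show "decomp_kernel \<subseteq> carrier_vec index" by (auto simp: decomp_kernel_def)
  show "0\<^sub>v index \<in> decomp_kernel" using coset_no(1) by (simp add: decomp_kernel_def)
  show "u + v \<in> decomp_kernel" if "u \<in> decomp_kernel" "v \<in> decomp_kernel" for u v
    using that by (simp add: decomp_kernel_def add)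
  show "c \<cdot>\<^sub>v v \<in> decomp_kernel" if "v \<in> decomp_kernel" for c v
    using that by (simp add: decomp_kernel_def smult)
qed

lemma decomp_kernel_invariant:
  assumes g: "g \<in> carrier G" and v: "v \<in> decomp_kernel"
  shows "coset_rep g *\<^sub>v v \<in> decomp_kernel"
proof -
  have vc: "v \<in> carrier_vec index" using v by (simp add: decomp_kernel_def)
  have "(\<Sum>J\<in>rcosets H. decomp_inv z J * (coset_rep g *\<^sub>v v) $ coset_no J) = 0" if z: "z \<in> index_set" for z
  proof -
    obtain \<rho> j i where zz: "z = ((\<rho>, j), i)" by (metis surj_pair)
    \<comment> \<open>\<open>J\<close> is rewritten as \<open>J #> g #> inv g\<close>, so that the
      summand depends on \<open>J #> g\<close> only and can be reindexed.\<close>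
    have "(\<Sum>J\<in>rcosets H. decomp_inv z J * (coset_rep g *\<^sub>v v) $ coset_no J)
        = (\<Sum>J\<in>rcosets H. decomp_inv z (J #> g #> inv g) * v $ coset_no (J #> g))"
      using coset_rep_mult_vec[OF _ g vc] g
      by (intro sum.cong) (auto simp: coset_mult_mult coset_carrier)
    also have "\<dots> = (\<Sum>J\<in>rcosets H. decomp_inv z (J #> inv g) * v $ coset_no J)"
      by (rule sum.reindex_bij_betw[OF bij_betw_coset_mult[OF g]])
    also have "\<dots> = (\<Sum>J\<in>rcosets H. \<Sum>l<rep_dim G \<rho>. \<rho> g $$ (i, l) * (decomp_inv ((\<rho>, j), l) J * v $ coset_no J))"
      using decomp_inv_translate[OF z[unfolded zz] _ g]
      by (simp add: zz sum_distrib_right mult.assoc del: decomp_inv.simps)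
    also have "\<dots> = (\<Sum>l<rep_dim G \<rho>. \<rho> g $$ (i, l) * (\<Sum>J\<in>rcosets H. decomp_inv ((\<rho>, j), l) J * v $ coset_no J))"
      unfolding sum_distrib_left by (rule sum.swap)
    also have "\<dots> = 0"
    proof (rule sum.neutral, rule ballI)
      fix l assume "l \<in> {..<rep_dim G \<rho>}"
      then have "((\<rho>, j), l) \<in> index_set" using z by (auto simp: zz index_set_def)
      then show "\<rho> g $$ (i, l) * (\<Sum>J\<in>rcosets H. decomp_inv ((\<rho>, j), l) J * v $ coset_no J) = 0"
        using v unfolding decomp_kernel_def by (simp del: decomp_inv.simps)
    qed
    finally show ?thesis .
  qed
  then show ?thesis using vc coset_rep_carrier[of g] by (auto simp: decomp_kernel_def)
qed

text \<open>
  A copy of \<open>\<rho>\<close> in the kernel is determined by its row at the trivial coset, which is fixed by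
  \<open>H\<close> and orthogonal to the \<open>H\<close>-fixed vectors, hence zero.
\<close>

lemma decomp_kernel_trivial: "decomp_kernel = {0\<^sub>v index}"
proof (rule ccontr)
  assume "decomp_kernel \<noteq> {0\<^sub>v index}"
  then obtain \<rho> E where \<rho>: "\<rho> \<in> Irep" and E: "E \<in> carrier_mat index (rep_dim G \<rho>)"
    and nz: "E \<noteq> 0\<^sub>m index (rep_dim G \<rho>)"
    and RE: "\<And>g. g \<in> carrier G \<Longrightarrow> coset_rep g * E = E * \<rho> g"
    and ker: "(*\<^sub>v) E ` carrier_vec (rep_dim G \<rho>) \<subseteq> decomp_kernel"
    using invariant_subspace_contains_irrep[OF complete_Irep unitary_coset_rep,
        unfolded rep_dim_coset_rep, OF subspace_decomp_kernel decomp_kernel_invariant] by metis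
  let ?d = "rep_dim G \<rho>"
  have H: "H \<in> rcosets H" using rcosetsI[OF H_subset one_closed] H_subset by simp
  define w where "w l = E $$ (coset_no H, l)" for l
  \<comment> \<open>Comparing the rows at the coset H in R(g) E = E \<rho>(g) shows that the single
    row \<open>w\<close> determines all of \<open>E\<close>.\<close>
  have row: "E $$ (coset_no (H #> g), i) = (\<Sum>b<?d. w b * \<rho> g $$ (b, i))"
    if g: "g \<in> carrier G" and i: "i < ?d" for g i
  proof -
    note C = unitary_repD(1)[OF Irep_props(1)[OF \<rho>] g]
    note Hg = coset_mult_closed[OF H g]
    have "E $$ (coset_no (H #> g), i) = (E *\<^sub>v unit_vec ?d i) $ coset_no (H #> g)"
      using E i coset_no(1)[OF Hg] by (simp add: mat_mult_unit_vec[OF E i])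
    also have "\<dots> = (coset_rep g *\<^sub>v (E *\<^sub>v unit_vec ?d i)) $ coset_no H"
      using E by (intro coset_rep_mult_vec[OF H g, symmetric]) auto
    also have "coset_rep g *\<^sub>v (E *\<^sub>v unit_vec ?d i) = E * \<rho> g *\<^sub>v unit_vec ?d i"
      unfolding RE[OF g, symmetric]
      by (rule assoc_mult_mat_vec[OF coset_rep_carrier E unit_vec_carrier, symmetric])
    also have "\<dots> = col (E * \<rho> g) i" by (rule mat_mult_unit_vec[OF mult_carrier_mat[OF E C] i])
    also have "\<dots> $ coset_no H = (\<Sum>b<?d. w b * \<rho> g $$ (b, i))"
      using E C i coset_no(1)[OF H] by (simp add: w_def scalar_prod_def atLeast0LessThan)
    finally show ?thesis .
  qed
  have row_repr: "E $$ (coset_no J, i) = (\<Sum>b<?d. w b * \<rho> (coset_repr J) $$ (b, i))"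
    if "J \<in> rcosets H" "i < ?d" for J i
    using row[OF coset_repr(1)[OF that(1)] that(2)] coset_repr(2)[OF that(1)] by simp
  have H_fix: "H #> h = H" if "h \<in> H" for h
    using that H_subset by (intro coset_join2 subgroup_H) auto
  have inv: "(\<Sum>b<?d. w b * \<rho> (h \<otimes> g) $$ (b, k)) = (\<Sum>b<?d. w b * \<rho> g $$ (b, k))"
    if h: "h \<in> H" and g: "g \<in> carrier G" and k: "k < ?d" for h g k
  proof -
    have hG: "h \<in> carrier G" using h H_subset by blast
    have "H #> (h \<otimes> g) = H #> g"
      using coset_mult_assoc[OF H_subset hG g] H_fix[OF h] by simp
    then show ?thesis using row[OF m_closed[OF hG g] k] row[OF g k] by simp
  qed
  \<comment> \<open>Column 0 of \<open>E\<close>, which exists as the dimension is positive, lies in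
    the kernel; its pairing with the row ((\<rho>, j), 0) is the entry \<open>j\<close> of w
    U.\<close>
  have orth: "(\<Sum>a<?d. w a * left_factor \<rho> $$ (a, j)) = 0" if j: "j < isotypic_mult \<rho>" for j
  proof -
    note d = Irep_props(3)[OF \<rho>]
    have z: "((\<rho>, j), 0) \<in> index_set" using \<rho> j d by (simp add: index_set_def)
    have "E *\<^sub>v unit_vec ?d 0 \<in> decomp_kernel" using ker by auto
    then have "(\<Sum>J\<in>rcosets H. decomp_inv ((\<rho>, j), 0) J * (E *\<^sub>v unit_vec ?d 0) $ coset_no J) = 0"
      using z unfolding decomp_kernel_def by blast
    moreover have "(E *\<^sub>v unit_vec ?d 0) $ coset_no J = (\<Sum>b<?d. w b * \<rho> (coset_repr J) $$ (b, 0))"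
      if "J \<in> rcosets H" for J
      using row_repr[OF that d] E d coset_no(1)[OF that] by (simp add: mat_mult_unit_vec[OF E d])
    ultimately show ?thesis
      using decomp_inv_orthogonal[OF z \<rho> d inv[OF _ _ d]] by (simp del: decomp_inv.simps)
  qed
  \<comment> \<open>\<open>w\<close> is fixed by H, hence w = w P = (w U) W, and w U = 0.\<close>
  have "w b = 0" if b: "b < ?d" for b
  proof -
    have wh: "(\<Sum>a<?d. w a * \<rho> h $$ (a, b)) = w b" if "h \<in> H" for h
      using row[of h b] b H_fix[OF that] that H_subset by (auto simp: w_def)
    have "(\<Sum>a<?d. w a * proj \<rho> $$ (a, b)) = (\<Sum>h\<in>H. \<Sum>a<?d. w a * \<rho> h $$ (a, b)) / of_nat (card H)"
      using b by (subst sum.swap) (simp add: proj_index sum_distrib_left sum_divide_distrib)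
    also have "\<dots> = w b" using card_H_pos by (simp add: wh)
    finally have "w b = (\<Sum>a<?d. w a * proj \<rho> $$ (a, b))" by simp
    also have "\<dots> = (\<Sum>a<?d. \<Sum>j<isotypic_mult \<rho>. w a * left_factor \<rho> $$ (a, j) * right_factor \<rho> $$ (j, b))"
    proof (rule sum.cong[OF refl])
      fix a assume "a \<in> {..<?d}"
      then show "w a * proj \<rho> $$ (a, b)
          = (\<Sum>j<isotypic_mult \<rho>. w a * left_factor \<rho> $$ (a, j) * right_factor \<rho> $$ (j, b))"
        unfolding factors(4)[OF \<rho>, symmetric] using b factors(1,2)[OF \<rho>]
        by (simp add: scalar_prod_def atLeast0LessThan sum_distrib_left mult.assoc)
    qed
    also have "\<dots> = (\<Sum>j<isotypic_mult \<rho>. (\<Sum>a<?d. w a * left_factor \<rho> $$ (a, j)) * right_factor \<rho> $$ (j, b))"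
      unfolding sum_distrib_right by (rule sum.swap)
    also have "\<dots> = 0" using orth by simp
    finally show ?thesis .
  qed
  then have "E $$ (coset_no J, i) = 0" if "J \<in> rcosets H" "i < ?d" for J i
    using row_repr[OF that] by simp
  then have "E = 0\<^sub>m index ?d"
    using E coset_no(3,4) by (intro eq_matI) (auto, metis)
  then show False using nz by simp
qed

text \<open>With P for \<open>decomp\<close> and Q for \<open>decomp_inv\<close>, Q (1 - P Q) = Q -
  (Q P) Q = 0. So every column of 1 - P Q lies in the trivial kernel; \<open>f\<close> is column
  \<open>K\<close>.\<close>

lemma decomp_decomp_inv:
  assumes J: "J \<in> rcosets H" and K: "K \<in> rcosets H"
  shows "(\<Sum>z\<in>index_set. decomp J z * decomp_inv z K) = of_bool (J = K)"
proof -
  define f where "f J = of_bool (J = K) - (\<Sum>z\<in>index_set. decomp J z * decomp_inv z K)" for J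
  define v where "v = vec index (\<lambda>l. f (coset_at l))"
  have vf: "v $ coset_no J = f J" if "J \<in> rcosets H" for J
    using coset_no(1,2)[OF that] by (simp add: v_def)
  have "(\<Sum>J\<in>rcosets H. decomp_inv z J * f J) = 0" if z: "z \<in> index_set" for z
  proof -
    have "(\<Sum>J\<in>rcosets H. decomp_inv z J * f J)
        = (\<Sum>J\<in>rcosets H. decomp_inv z J * of_bool (J = K))
          - (\<Sum>J\<in>rcosets H. \<Sum>z'\<in>index_set. decomp_inv z J * decomp J z' * decomp_inv z' K)"
      unfolding f_def by (simp add: right_diff_distrib sum_subtractf sum_distrib_left mult.assoc)
    also have "(\<Sum>J\<in>rcosets H. decomp_inv z J * of_bool (J = K)) = decomp_inv z K"
      using K finite_cosets by (simp add: of_bool_def if_distrib cong: if_cong)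
    also have "(\<Sum>J\<in>rcosets H. \<Sum>z'\<in>index_set. decomp_inv z J * decomp J z' * decomp_inv z' K)
        = (\<Sum>z'\<in>index_set. (\<Sum>J\<in>rcosets H. decomp_inv z J * decomp J z') * decomp_inv z' K)"
      unfolding sum_distrib_right by (rule sum.swap)
    also have "\<dots> = (\<Sum>z'\<in>index_set. if z' = z then decomp_inv z K else 0)"
      using decomp_inv_decomp[OF z] by (intro sum.cong) auto
    also have "\<dots> = decomp_inv z K" using z finite_index_set by simp
    finally show ?thesis by simp
  qed
  then have "v \<in> decomp_kernel" using vf by (simp add: decomp_kernel_def) (simp add: v_def)
  then have "f J = 0" using vf[OF J] coset_no(1)[OF J] by (simp add: decomp_kernel_trivial)
  then show ?thesis by (simp add: f_def)
qed

section \<open>The spectrum of the relative lift\<close>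

text \<open>The change of basis on cosets, tensored with the identity on the vertices, conjugates
  the adjacency matrix to block diagonal form.\<close>

lemma eigenvalue_mset_relative_lift:
  fixes \<Gamma> :: "('v, 'e) pre_digraph"
  assumes fin: "finite (verts \<Gamma>)" "finite (arcs \<Gamma>)"
    and \<alpha>: "\<And>a. a \<in> arcs \<Gamma> \<Longrightarrow> \<alpha> a \<in> carrier G"
  shows "eigenvalue_mset (adjacency_mat (relative_lift \<Gamma> G H \<alpha>))
    = (\<Sum>\<rho>\<in>Irep. repeat_mset (isotypic_mult \<rho>) (eigenvalue_mset (rep_base_matrix \<Gamma> G \<alpha> \<rho>)))"
proof -
  let ?V = "verts \<Gamma>" and ?S = "Sigma Irep (\<lambda>\<rho>. {..<isotypic_mult \<rho>})"
  \<comment> \<open>In \<open>?K\<close> the copy comes first and the vertex second, so each block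
    is indexed exactly like \<open>rep_base_matrix\<close>.\<close>
  let ?I = "?V \<times> rcosets H" and ?K = "Sigma ?S (\<lambda>s. ?V \<times> {..<rep_dim G (fst s)})"
  define M where "M s = (\<lambda>(u, i) (v, j). rep_alg G (fst s) (base_matrix \<Gamma> \<alpha> u v) $$ (i, j))"
    for s :: "('a \<Rightarrow> complex mat) \<times> nat"
  define A where "A x y = complex_of_nat (card {e \<in> arcs (relative_lift \<Gamma> G H \<alpha>).
      tail (relative_lift \<Gamma> G H \<alpha>) e = x \<and> head (relative_lift \<Gamma> G H \<alpha>) e = y})" for x y
  define D where "D = (\<lambda>(s, x) (t, y). if s = t then M s x y else 0)"
  define p :: "'v \<times> 'a set \<Rightarrow> (('a \<Rightarrow> complex mat) \<times> nat) \<times> 'v \<times> nat \<Rightarrow> complex"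
    where "p = (\<lambda>(u, J) (s, v, i). of_bool (u = v) * decomp J (s, i))"
  define q :: "(('a \<Rightarrow> complex mat) \<times> nat) \<times> 'v \<times> nat \<Rightarrow> 'v \<times> 'a set \<Rightarrow> complex"
    where "q = (\<lambda>(s, v, i) (u, J). of_bool (v = u) * decomp_inv (s, i) J)"
  let ?arcs = "\<lambda>u v. {a \<in> arcs \<Gamma>. tail \<Gamma> a = u \<and> head \<Gamma> a = v}"
  have finIrep: "finite Irep" by (rule finite_complete_unitary_irreps[OF finite_carrier complete_Irep])
  then have finS: "finite ?S" by simp
  have sumK: "(\<Sum>z\<in>?K. f z) = (\<Sum>s\<in>?S. \<Sum>v\<in>?V. \<Sum>i<rep_dim G (fst s). f (s, v, i))" for f :: "_ \<Rightarrow> complex"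
    using sum.Sigma[of ?S "\<lambda>s. ?V \<times> {..<rep_dim G (fst s)}" "\<lambda>s x. f (s, x)"] finS fin
    by (simp add: sum.cartesian_product case_prod_beta)
  have sumZ: "(\<Sum>z\<in>index_set. f z) = (\<Sum>s\<in>?S. \<Sum>i<rep_dim G (fst s). f (s, i))" for f :: "_ \<Rightarrow> complex"
    unfolding index_set_def using finS by (subst sum.Sigma) auto
  have "eigenvalue_mset (mat_on ?I A) = eigenvalue_mset (mat_on ?K D)"
  proof (rule eigenvalue_mset_similar)
    show "finite ?I" using fin finite_cosets by simp
    show "finite ?K" using finS fin by auto
  next
    fix x y assume "x \<in> ?I" "y \<in> ?I"
    then obtain u J v J' where xy: "x = (u, J)" "y = (v, J')"
      and u: "u \<in> ?V" "J \<in> rcosets H" "v \<in> ?V" "J' \<in> rcosets H" by auto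
    have "(\<Sum>z\<in>?K. p x z * q z y)
        = (\<Sum>s\<in>?S. \<Sum>v'\<in>?V. if v' = u then of_bool (u = v) * (\<Sum>i<rep_dim G (fst s). decomp J (s, i) * decomp_inv (s, i) J') else 0)"
      unfolding sumK by (intro sum.cong refl) (auto simp: p_def q_def xy sum_distrib_left)
    also have "\<dots> = of_bool (u = v) * (\<Sum>z\<in>index_set. decomp J z * decomp_inv z J')"
      unfolding sumZ sum_distrib_left using u fin by simp
    finally show "(\<Sum>z\<in>?K. p x z * q z y) = of_bool (x = y)"
      using decomp_decomp_inv[OF u(2,4)] by (auto simp: xy)
  next
    fix x y assume "x \<in> ?K" "y \<in> ?K"
    then obtain s u i t v k where xy: "x = (s, u, i)" "y = (t, v, k)"
      and u: "u \<in> ?V" "v \<in> ?V" and z: "(s, i) \<in> index_set" "(t, k) \<in> index_set"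
      by (auto simp: index_set_def)
    have "(\<Sum>z\<in>?I. q x z * p z y)
        = (\<Sum>v'\<in>?V. if v' = u then of_bool (u = v) * (\<Sum>J\<in>rcosets H. decomp_inv (s, i) J * decomp J (t, k)) else 0)"
      unfolding sum.cartesian_product' by (intro sum.cong refl) (auto simp: p_def q_def xy sum_distrib_left)
    also have "\<dots> = of_bool (u = v) * (\<Sum>J\<in>rcosets H. decomp_inv (s, i) J * decomp J (t, k))"
      using u fin by simp
    finally show "(\<Sum>z\<in>?I. q x z * p z y) = of_bool (x = y)"
      using decomp_inv_decomp[OF z] by (auto simp: xy)
  next
    fix x y assume "x \<in> ?I" "y \<in> ?K"
    then obtain u J \<rho> m v i where xy: "x = (u, J)" "y = ((\<rho>, m), v, i)"
      and u: "u \<in> ?V" "J \<in> rcosets H" "v \<in> ?V" and s: "(\<rho>, m) \<in> ?S" and i: "i < rep_dim G \<rho>"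
      and z: "((\<rho>, m), i) \<in> index_set"
      by (auto simp: index_set_def)
    have finA: "finite (?arcs u v)" using fin by simp
    have Aentry: "A (u, J) (v, J') = (\<Sum>a\<in>?arcs u v. of_bool (J #> \<alpha> a = J'))" for J'
    proof -
      have "{a \<in> arcs \<Gamma>. tail \<Gamma> a = u \<and> head \<Gamma> a = v \<and> J #> \<alpha> a = J'} = ?arcs u v \<inter> {a. J #> \<alpha> a = J'}" by auto
      then show ?thesis
        using finA by (simp add: A_def adjacency_relative_lift_entry[OF u(2)] sum_of_bool_eq)
    qed
    have "(\<Sum>z\<in>?I. A x z * p z y) = (\<Sum>v'\<in>?V. if v' = v then (\<Sum>J'\<in>rcosets H. A (u, J) (v, J') * decomp J' ((\<rho>, m), i)) else 0)"
      unfolding sum.cartesian_product' by (intro sum.cong refl) (auto simp: p_def xy)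
    also have "\<dots> = (\<Sum>J'\<in>rcosets H. \<Sum>a\<in>?arcs u v. of_bool (J #> \<alpha> a = J') * decomp J' ((\<rho>, m), i))"
      using u fin by (simp add: Aentry sum_distrib_right del: decomp.simps)
    also have "\<dots> = (\<Sum>a\<in>?arcs u v. \<Sum>J'\<in>rcosets H. of_bool (J #> \<alpha> a = J') * decomp J' ((\<rho>, m), i))"
      by (rule sum.swap)
    also have "\<dots> = (\<Sum>a\<in>?arcs u v. decomp (J #> \<alpha> a) ((\<rho>, m), i))"
    proof (rule sum.cong[OF refl])
      fix a assume "a \<in> ?arcs u v"
      then have "J #> \<alpha> a \<in> rcosets H" using coset_mult_closed[OF u(2)] \<alpha> by auto
      moreover have "(\<Sum>J'\<in>rcosets H. of_bool (J #> \<alpha> a = J') * decomp J' ((\<rho>, m), i))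
          = (\<Sum>J'\<in>rcosets H. if J' = J #> \<alpha> a then decomp (J #> \<alpha> a) ((\<rho>, m), i) else 0)"
        by (intro sum.cong) (auto simp del: decomp.simps)
      ultimately show "(\<Sum>J'\<in>rcosets H. of_bool (J #> \<alpha> a = J') * decomp J' ((\<rho>, m), i)) = decomp (J #> \<alpha> a) ((\<rho>, m), i)"
        using finite_cosets by (simp del: decomp.simps)
    qed
    also have "\<dots> = (\<Sum>a\<in>?arcs u v. \<Sum>l<rep_dim G \<rho>. decomp J ((\<rho>, m), l) * \<rho> (\<alpha> a) $$ (l, i))"
      using decomp_translate[OF z u(2)] \<alpha> by (intro sum.cong) (auto simp del: decomp.simps)
    also have "\<dots> = (\<Sum>l<rep_dim G \<rho>. decomp J ((\<rho>, m), l) * (\<Sum>a\<in>?arcs u v. \<rho> (\<alpha> a) $$ (l, i)))"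
      unfolding sum_distrib_left by (rule sum.swap)
    also have "\<dots> = (\<Sum>l<rep_dim G \<rho>. decomp J ((\<rho>, m), l) * M (\<rho>, m) (u, l) (v, i))"
      using rep_alg_sum_single[OF finA _ i, of _ \<alpha>]
      by (intro sum.cong refl) (simp add: M_def base_matrix_def del: decomp.simps)
    \<comment> \<open>Restores the full sum over \<open>?K\<close>: \<open>D\<close> vanishes on the
      other copies and \<open>p\<close> on the other vertices.\<close>
    also have "\<dots> = (\<Sum>t\<in>?S. if t = (\<rho>, m) then (\<Sum>v'\<in>?V. if v' = u then (\<Sum>l<rep_dim G \<rho>. decomp J ((\<rho>, m), l) * M (\<rho>, m) (u, l) (v, i)) else 0) else 0)"
      using s u fin finS by (simp del: decomp.simps)
    also have "\<dots> = (\<Sum>z\<in>?K. p x z * D z y)"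
      unfolding sumK by (intro sum.cong refl) (auto simp: p_def D_def xy simp del: decomp.simps intro!: sum.cong)
    finally show "(\<Sum>z\<in>?I. A x z * p z y) = (\<Sum>z\<in>?K. p x z * D z y)" .
  qed
  moreover have "adjacency_mat (relative_lift \<Gamma> G H \<alpha>) = mat_on ?I A"
    unfolding adjacency_mat_def A_def[abs_def] by (simp add: relative_lift_def)
  moreover have "eigenvalue_mset (mat_on ?K D)
      = (\<Sum>s\<in>?S. eigenvalue_mset (mat_on (?V \<times> {..<rep_dim G (fst s)}) (M s)))"
    unfolding D_def using finS fin by (intro eigenvalue_mset_block_diag) auto
  moreover have "\<dots> = (\<Sum>s\<in>?S. eigenvalue_mset (rep_base_matrix \<Gamma> G \<alpha> (fst s)))"
    by (simp add: M_def rep_base_matrix_def)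
  \<comment> \<open>The block of (\<rho>, j) depends on \<rho> alone, so summing over
    \<open>j\<close> merely repeats its spectrum.\<close>
  moreover have "\<dots> = (\<Sum>\<rho>\<in>Irep. \<Sum>j<isotypic_mult \<rho>. eigenvalue_mset (rep_base_matrix \<Gamma> G \<alpha> \<rho>))"
    using finIrep by (subst sum.Sigma) (auto simp: case_prod_beta)
  ultimately show ?thesis by (simp add: sum_constant_mset)
qed

end

theorem theorem4p1:
  fixes \<Gamma> :: "('v, 'e) pre_digraph"
    and arev :: "'e \<Rightarrow> 'e"
    and G :: "('g, 'm) monoid_scheme"
    and H :: "'g set"
    and \<alpha> :: "'e \<Rightarrow> 'g"
    and Irep :: "('g \<Rightarrow> complex mat) set"
    and k n :: nat
  assumes "fin_digraph \<Gamma>"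
    and "bidirected_digraph \<Gamma> arev"
    and "card (verts \<Gamma>) = k"
    and "group G"
    and "finite (carrier G)"
    and "subgroup H G"
    and "card (rcosets\<^bsub>G\<^esub> H) = n"
    and "voltage_assignment \<Gamma> arev G \<alpha>"
    and "complete_unitary_irreps G Irep"
  shows "size (eigenvalue_mset (adjacency_mat (relative_lift \<Gamma> G H \<alpha>))) = k * n \<and>
    eigenvalue_mset (adjacency_mat (relative_lift \<Gamma> G H \<alpha>)) =
      (\<Sum>\<rho>\<in>Irep. repeat_mset (vec_space.rank (rep_dim G \<rho>) (rep_subset_sum G \<rho> H))
                            (eigenvalue_mset (rep_base_matrix \<Gamma> G \<alpha> \<rho>)))"
proof
  interpret fin_digraph \<Gamma> by fact
  interpret group G by fact
  interpret finite_coset_space G H Irep by (intro finite_coset_space.intro finite_coset_space_axioms.intro assms)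
  have "verts (relative_lift \<Gamma> G H \<alpha>) = verts \<Gamma> \<times> rcosets\<^bsub>G\<^esub> H" by (simp add: relative_lift_def)
  then show "size (eigenvalue_mset (adjacency_mat (relative_lift \<Gamma> G H \<alpha>))) = k * n"
    using assms(3,7)
    by (simp add: adjacency_mat_def card_cartesian_product size_eigenvalue_mset[OF mat_on_carrier])
  show "eigenvalue_mset (adjacency_mat (relative_lift \<Gamma> G H \<alpha>)) =
      (\<Sum>\<rho>\<in>Irep. repeat_mset (vec_space.rank (rep_dim G \<rho>) (rep_subset_sum G \<rho> H))
                            (eigenvalue_mset (rep_base_matrix \<Gamma> G \<alpha> \<rho>)))"
    using assms(8) unfolding isotypic_mult_def[symmetric] voltage_assignment_def
    by (intro eigenvalue_mset_relative_lift) auto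
qed

end
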